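(* Let $P:\mathcal{C}^{\mathrm{op}}\to\mathbf{InfSL}$ be an elementary existential doctrine with weak full comprehensions. Suppose moreover that, for all objects $A$ and $B$ of $\mathcal{C}$ and every $\alpha\in P(A\times B)$ such that $\top_A\le\exists_{\mathrm{pr}}(\alpha)$, where $\mathrm{pr}:A\times B\to A$ is the first projection, there is an arrow $w:A\to B$ in $\mathcal{C}$ such that $\top_A\le P_{\langle \mathrm{id}_A,w\rangle}(\alpha)$. Then the canonical functor $L:\mathcal{Q}_P\to\mathcal{E}_P$ from the elementary quotient completion of $P$ to the category of $P$-equivalence relations and functional relations is an equivalence of categories.
   Context: $\mathbf{InfSL}$ is the category of inf-semilattices (posets with finite meets, including a top element $\top$) and homomorphisms. For $P:\mathcal{C}^{\mathrm{op}}\to\mathbf{InfSL}$ and $f:A\to B$ in $\mathcal{C}$, write $P_f:P(B)\to P(A)$ for its action and $\top_A$ for the top of $P(A)$. An **elementary doctrine** is a functor $P:\mathcal{C}^{\mathrm{op}}\to\mathbf{InfSL}$, with $\mathcal{C}$ a category with binary products, such that for every object $A$ there is $\delta_A\in P(A\times A)$ with: (i) $\alpha\mapsto P_{\mathrm{pr}_1}(\alpha)\wedge\delta_A$ is left adjoint to $P_{\langle \mathrm{id}_A,\mathrm{id}_A\rangle}:P(A\times A)\to P(A)$; (ii) for every $e=\langle \mathrm{pr}_1,\mathrm{pr}_2,\mathrm{pr}_2\rangle:X\times A\to X\times A\times A$, the assignment $\alpha\mapsto P_{\langle \mathrm{pr}_1,\mathrm{pr}_2\rangle}(\alpha)\wedge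 P_{\langle \mathrm{pr}_2,\mathrm{pr}_3\rangle}(\delta_A)$ is left adjoint to $P_e$. It is **existential** if for each product projection $\mathrm{pr}:A_1\times A_2\to A_i$ the map $P_{\mathrm{pr}}$ has a left adjoint $\exists_{\mathrm{pr}}$, satisfying Beck–Chevalley (for every pullback of a projection $\mathrm{pr}:X\to A$ along $f:A'\to A$, with resulting $\mathrm{pr}':X'\to A'$ and $f':X'\to X$, $\exists_{\mathrm{pr}'}P_{f'}(\beta)=P_f\exists_{\mathrm{pr}}(\beta)$ for all $\beta\in P(X)$) and Frobenius reciprocity ($\exists_{\mathrm{pr}}(P_{\mathrm{pr}}(\alpha)\wedge\beta)=\alpha\wedge\exists_{\mathrm{pr}}(\beta)$). A **weak comprehension** of $\alpha\in P(A)$ is a map $c:W\to A$ with $P_c(\alpha)=\top_W$ such that every $f:Z\to A$ with $P_f(\alpha)=\top_Z$ factors as $f=c\circ g$ for some (not necessarily unique) $g:Z\to W$. $P$ has **weak full comprehensions** if every $\alpha$ has a weak comprehension and, for $\alpha,\beta\in P(A)$, $\alpha\le\beta$ whenever a weak comprehension of $\alpha$ factors through one of $\beta$. A **$P$-equivalence relation** on $A$ is $\rho\in P(A\times A)$ with $\delta_A\le\rho$, $\rho\le P_{\langle p_2,p_1\rangle}(\rho)$, and $P_{\langle p_1,p_2\rangle}(\rho)\wedge P_{\langle p_2,p_3\rangle}(\rho)\le P_{\langle p_1,p_3\rangle}(\rho)$ in $P(A\times A\times A)$. **Elementary quotient completion $\mathcal{Q}_P$.** Objects are pairs $(A,\rho)$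 with $\rho$ a $P$-equivalence relation on $A$. An arrow $[f]:(A,\rho)\to(B,\sigma)$ is an equivalence class of arrows $f:A\to B$ in $\mathcal{C}$ with $\rho\le P_{f\times f}(\sigma)$, where $f$ and $g$ are equivalent when $\rho\le P_{f\times g}(\sigma)$. Composition and identities are those of $\mathcal{C}$ on representatives. **Category $\mathcal{E}_P$.** Objects are pairs $(A,\rho)$ with $\rho$ a $P$-equivalence relation on $A$. An arrow $(A,\rho)\to(B,\sigma)$ is $\phi\in P(A\times B)$ such that: $P_{\langle p_1,p_2\rangle}(\rho)\wedge P_{\langle p_2,p_3\rangle}(\phi)\le P_{\langle p_1,p_3\rangle}(\phi)$ in $P(A\times A\times B)$; $P_{\langle p_1,p_2\rangle}(\phi)\wedge P_{\langle p_2,p_3\rangle}(\sigma)\le P_{\langle p_1,p_3\rangle}(\phi)$ in $P(A\times B\times B)$; $P_{\langle p_1,p_2\rangle}(\phi)\wedge P_{\langle p_1,p_3\rangle}(\phi)\le P_{\langle p_2,p_3\rangle}(\sigma)$ in $P(A\times B\times B)$; and $\top_A\le\exists_{p_1}(\phi)$ with $p_1:A\times B\to A$ the first projection. The composite of $\phi:(A,\rho)\to(B,\sigma)$ and $\psi:(B,\sigma)\to(C,\tau)$ is $\exists_{\langle p_1,p_3\rangle}(P_{\langle p_1,p_2\rangle}(\phi)\wedge P_{\langle p_2,p_3\rangle}(\psi))$, with $p_i$ the projections from $A\times B\times C$; the identity on $(A,\rho)$ is $\rho$. **Functor $L$.** $L:\mathcal{Q}_P\to\mathcal{E}_P$ is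 the identity on objects, and for $[f]:(A,\rho)\to(B,\sigma)$, $$L[f]=\exists_{\langle p_1,p_3\rangle}\bigl(P_{\langle p_1,p_2\rangle}(\rho)\wedge P_{\langle f\circ p_2,\,p_3\rangle}(\sigma)\bigr)\in P(A\times B),$$ with $p_1,p_2,p_3$ the projections from $A\times A\times B$. *)

theory Defs
  imports "HOL-Algebra.Galois_Connection"
begin

section \<open>Categories\<close>

record ('o, 'a) cat =
  Obj :: "'o set"
  Arr :: "'a set"
  Dom :: "'a \<Rightarrow> 'o"
  Cod :: "'a \<Rightarrow> 'o"
  Ident :: "'o \<Rightarrow> 'a"
  Comp :: "'a \<Rightarrow> 'a \<Rightarrow> 'a"  (infixr \<open>\<cdot>\<index>\<close> 75)

definition hom :: "('o, 'a, 'm) cat_scheme \<Rightarrow> 'o \<Rightarrow> 'o \<Rightarrow> 'a set" where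
  "hom C A B = {f \<in> Arr C. Dom C f = A \<and> Cod C f = B}"

text \<open>\<open>g \<cdot> f\<close> is \<open>g\<close> after \<open>f\<close>; it is constrained only when \<open>Cod f = Dom g\<close>.\<close>

locale category =
  fixes C :: "('o, 'a, 'm) cat_scheme" (structure)
  assumes dom_obj: "f \<in> Arr C \<Longrightarrow> Dom C f \<in> Obj C"
    and cod_obj: "f \<in> Arr C \<Longrightarrow> Cod C f \<in> Obj C"
    and ident_hom: "A \<in> Obj C \<Longrightarrow> Ident C A \<in> hom C A A"
    and comp_hom: "\<lbrakk>f \<in> hom C X Y; g \<in> hom C Y Z\<rbrakk> \<Longrightarrow> g \<cdot> f \<in> hom C X Z"
    and ident_right: "f \<in> hom C X Y \<Longrightarrow> f \<cdot> Ident C X = f"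
    and ident_left: "f \<in> hom C X Y \<Longrightarrow> Ident C Y \<cdot> f = f"
    and comp_assoc: "\<lbrakk>f \<in> hom C X Y; g \<in> hom C Y Z; h \<in> hom C Z W\<rbrakk>
                      \<Longrightarrow> h \<cdot> (g \<cdot> f) = (h \<cdot> g) \<cdot> f"

record ('o, 'a, 'u, 'b) func =
  on_obj :: "'o \<Rightarrow> 'u"
  on_arr :: "'a \<Rightarrow> 'b"

definition is_functor ::
    "('o, 'a, 'm) cat_scheme \<Rightarrow> ('u, 'b, 'n) cat_scheme \<Rightarrow> ('o, 'a, 'u, 'b) func \<Rightarrow> bool" where
  "is_functor C D F \<longleftrightarrow>
     category C \<and> category D \<and>
     (\<forall>A\<in>Obj C. on_obj F A \<in> Obj D) \<and>
     (\<forall>A\<in>Obj C. \<forall>B\<in>Obj C. \<forall>f\<in>hom C A B. on_arr F f \<in> hom D (on_obj F A) (on_obj F B)) \<and>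
     (\<forall>A\<in>Obj C. on_arr F (Ident C A) = Ident D (on_obj F A)) \<and>
     (\<forall>X\<in>Obj C. \<forall>Y\<in>Obj C. \<forall>Z\<in>Obj C. \<forall>f\<in>hom C X Y. \<forall>g\<in>hom C Y Z.
        on_arr F (g \<cdot>\<^bsub>C\<^esub> f) = on_arr F g \<cdot>\<^bsub>D\<^esub> on_arr F f)"

definition id_func :: "('o, 'a, 'o, 'a) func" where
  "id_func = \<lparr>on_obj = \<lambda>A. A, on_arr = \<lambda>f. f\<rparr>"

definition comp_func ::
    "('u, 'b, 'v, 'c) func \<Rightarrow> ('o, 'a, 'u, 'b) func \<Rightarrow> ('o, 'a, 'v, 'c) func" where
  "comp_func G F = \<lparr>on_obj = on_obj G \<circ> on_obj F, on_arr = on_arr G \<circ> on_arr F\<rparr>"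

definition is_iso :: "('o, 'a, 'm) cat_scheme \<Rightarrow> 'a \<Rightarrow> bool" where
  "is_iso C f \<longleftrightarrow> f \<in> Arr C \<and>
     (\<exists>g\<in>hom C (Cod C f) (Dom C f). g \<cdot>\<^bsub>C\<^esub> f = Ident C (Dom C f) \<and> f \<cdot>\<^bsub>C\<^esub> g = Ident C (Cod C f))"

definition is_natural_iso ::
    "('o, 'a, 'm) cat_scheme \<Rightarrow> ('u, 'b, 'n) cat_scheme \<Rightarrow>
     ('o, 'a, 'u, 'b) func \<Rightarrow> ('o, 'a, 'u, 'b) func \<Rightarrow> ('o \<Rightarrow> 'b) \<Rightarrow> bool" where
  "is_natural_iso C D F G \<eta> \<longleftrightarrow>
     (\<forall>A\<in>Obj C. \<eta> A \<in> hom D (on_obj F A) (on_obj G A) \<and> is_iso D (\<eta> A)) \<and>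
     (\<forall>A\<in>Obj C. \<forall>B\<in>Obj C. \<forall>f\<in>hom C A B.
        \<eta> B \<cdot>\<^bsub>D\<^esub> on_arr F f = on_arr G f \<cdot>\<^bsub>D\<^esub> \<eta> A)"

definition is_equivalence ::
    "('o, 'a, 'm) cat_scheme \<Rightarrow> ('u, 'b, 'n) cat_scheme \<Rightarrow> ('o, 'a, 'u, 'b) func \<Rightarrow> bool" where
  "is_equivalence C D F \<longleftrightarrow>
     is_functor C D F \<and>
     (\<exists>G. is_functor D C G \<and>
        (\<exists>\<eta>. is_natural_iso C C id_func (comp_func G F) \<eta>) \<and>
        (\<exists>\<epsilon>. is_natural_iso D D (comp_func F G) id_func \<epsilon>))"

definition is_product ::
    "('o, 'a, 'm) cat_scheme \<Rightarrow> 'o \<Rightarrow> 'o \<Rightarrow> 'o \<Rightarrow> 'a \<Rightarrow> 'a \<Rightarrow> bool" where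
  "is_product C A B X p q \<longleftrightarrow>
     p \<in> hom C X A \<and> q \<in> hom C X B \<and>
     (\<forall>Z\<in>Obj C. \<forall>f\<in>hom C Z A. \<forall>g\<in>hom C Z B.
        \<exists>!h. h \<in> hom C Z X \<and> p \<cdot>\<^bsub>C\<^esub> h = f \<and> q \<cdot>\<^bsub>C\<^esub> h = g)"

text \<open>A product projection is a leg of an arbitrary product cone, not only of a chosen one:
  for instance \<open>\<langle>p\<^sub>1, p\<^sub>3\<rangle> : A \<times> B \<times> C \<rightarrow> A \<times> C\<close> is one.\<close>

definition is_projection :: "('o, 'a, 'm) cat_scheme \<Rightarrow> 'a \<Rightarrow> bool" where
  "is_projection C p \<longleftrightarrow>
     (\<exists>A B X q. is_product C A B X p q) \<or> (\<exists>A B X q. is_product C A B X q p)"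

text \<open>\<open>is_pullback C p f p' f'\<close>: the square \<open>p \<cdot> f' = f \<cdot> p'\<close> is a pullback, where
  \<open>p : X \<rightarrow> A\<close>, \<open>f : A' \<rightarrow> A\<close>, \<open>p' : X' \<rightarrow> A'\<close> and \<open>f' : X' \<rightarrow> X\<close>.\<close>

definition is_pullback :: "('o, 'a, 'm) cat_scheme \<Rightarrow> 'a \<Rightarrow> 'a \<Rightarrow> 'a \<Rightarrow> 'a \<Rightarrow> bool" where
  "is_pullback C p f p' f' \<longleftrightarrow>
     p \<in> Arr C \<and> f \<in> Arr C \<and> Cod C p = Cod C f \<and>
     p' \<in> hom C (Dom C p') (Dom C f) \<and> f' \<in> hom C (Dom C p') (Dom C p) \<and>
     p \<cdot>\<^bsub>C\<^esub> f' = f \<cdot>\<^bsub>C\<^esub> p' \<and>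
     (\<forall>Z\<in>Obj C. \<forall>u\<in>hom C Z (Dom C f). \<forall>v\<in>hom C Z (Dom C p). p \<cdot>\<^bsub>C\<^esub> v = f \<cdot>\<^bsub>C\<^esub> u \<longrightarrow>
        (\<exists>!h. h \<in> hom C Z (Dom C p') \<and> p' \<cdot>\<^bsub>C\<^esub> h = u \<and> f' \<cdot>\<^bsub>C\<^esub> h = v))"


section \<open>Inf-semilattices and adjoints\<close>

locale inf_semilattice = lower_semilattice L + weak_partial_order_top L for L (structure)

definition inf_hom :: "('p, 'm) gorder_scheme \<Rightarrow> ('q, 'n) gorder_scheme \<Rightarrow> ('p \<Rightarrow> 'q) \<Rightarrow> bool" where
  "inf_hom S T h \<longleftrightarrow>
     h \<in> carrier S \<rightarrow> carrier T \<and> h \<top>\<^bsub>S\<^esub> = \<top>\<^bsub>T\<^esub> \<and>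
     (\<forall>x\<in>carrier S. \<forall>y\<in>carrier S. h (x \<sqinter>\<^bsub>S\<^esub> y) = h x \<sqinter>\<^bsub>T\<^esub> h y)"

definition left_adjoint :: "'p gorder \<Rightarrow> 'q gorder \<Rightarrow> ('p \<Rightarrow> 'q) \<Rightarrow> ('q \<Rightarrow> 'p) \<Rightarrow> bool" where
  "left_adjoint S T l r \<longleftrightarrow>
     galois_connection \<lparr>orderA = S, orderB = T, lower = l, upper = r\<rparr>"


section \<open>Doctrines\<close>

text \<open>The base category with chosen binary products \<open>Prod A B\<close>, \<open>pr1 A B\<close>, \<open>pr2 A B\<close>, the
  fibres \<open>P(A)\<close> and the reindexings \<open>P\<^sub>f\<close>.\<close>

record ('o, 'a, 'p) doctrine = "('o, 'a) cat" +
  Prod :: "'o \<Rightarrow> 'o \<Rightarrow> 'o"  (infixl \<open>\<otimes>\<index>\<close> 70)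
  pr1 :: "'o \<Rightarrow> 'o \<Rightarrow> 'a"
  pr2 :: "'o \<Rightarrow> 'o \<Rightarrow> 'a"
  fibre :: "'o \<Rightarrow> 'p gorder"  (\<open>\<F>\<index>\<close>)
  reindex :: "'a \<Rightarrow> 'p \<Rightarrow> 'p"

context
  fixes P :: "('o, 'a, 'p) doctrine" (structure)
begin

definition pair :: "'a \<Rightarrow> 'a \<Rightarrow> 'a" where
  "pair f g = (THE h. h \<in> hom P (Dom P f) (Cod P f \<otimes> Cod P g) \<and>
                 pr1 P (Cod P f) (Cod P g) \<cdot> h = f \<and> pr2 P (Cod P f) (Cod P g) \<cdot> h = g)"

definition prod_arr :: "'a \<Rightarrow> 'a \<Rightarrow> 'a" where
  "prod_arr f g = pair (f \<cdot> pr1 P (Dom P f) (Dom P g)) (g \<cdot> pr2 P (Dom P f) (Dom P g))"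

text \<open>Ternary products are \<open>A \<times> B \<times> C = (A \<times> B) \<times> C\<close>, with projections \<open>t1\<close>, \<open>t2\<close>, \<open>t3\<close>.\<close>

definition t1 :: "'o \<Rightarrow> 'o \<Rightarrow> 'o \<Rightarrow> 'a" where
  "t1 A B C = pr1 P A B \<cdot> pr1 P (A \<otimes> B) C"

definition t2 :: "'o \<Rightarrow> 'o \<Rightarrow> 'o \<Rightarrow> 'a" where
  "t2 A B C = pr2 P A B \<cdot> pr1 P (A \<otimes> B) C"

definition t3 :: "'o \<Rightarrow> 'o \<Rightarrow> 'o \<Rightarrow> 'a" where
  "t3 A B C = pr2 P (A \<otimes> B) C"

definition t12 :: "'o \<Rightarrow> 'o \<Rightarrow> 'o \<Rightarrow> 'a" where
  "t12 A B C = pair (t1 A B C) (t2 A B C)"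

definition t13 :: "'o \<Rightarrow> 'o \<Rightarrow> 'o \<Rightarrow> 'a" where
  "t13 A B C = pair (t1 A B C) (t3 A B C)"

definition t23 :: "'o \<Rightarrow> 'o \<Rightarrow> 'o \<Rightarrow> 'a" where
  "t23 A B C = pair (t2 A B C) (t3 A B C)"

definition is_doctrine :: bool where
  "is_doctrine \<longleftrightarrow>
     category P \<and>
     (\<forall>A\<in>Obj P. \<forall>B\<in>Obj P. is_product P A B (A \<otimes> B) (pr1 P A B) (pr2 P A B)) \<and>
     (\<forall>A\<in>Obj P. inf_semilattice (\<F> A)) \<and>
     (\<forall>A\<in>Obj P. \<forall>B\<in>Obj P. \<forall>f\<in>hom P A B. inf_hom (\<F> B) (\<F> A) (reindex P f)) \<and>
     (\<forall>A\<in>Obj P. \<forall>\<alpha>\<in>carrier (\<F> A). reindex P (Ident P A) \<alpha> = \<alpha>) \<and>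
     (\<forall>A\<in>Obj P. \<forall>B\<in>Obj P. \<forall>C\<in>Obj P. \<forall>f\<in>hom P A B. \<forall>g\<in>hom P B C. \<forall>\<alpha>\<in>carrier (\<F> C).
        reindex P (g \<cdot> f) \<alpha> = reindex P f (reindex P g \<alpha>))"

definition is_equality :: "'o \<Rightarrow> 'p \<Rightarrow> bool" where
  "is_equality A \<delta> \<longleftrightarrow>
     \<delta> \<in> carrier (\<F> (A \<otimes> A)) \<and>
     left_adjoint (\<F> A) (\<F> (A \<otimes> A))
       (\<lambda>\<alpha>. reindex P (pr1 P A A) \<alpha> \<sqinter>\<^bsub>\<F> (A \<otimes> A)\<^esub> \<delta>)
       (reindex P (pair (Ident P A) (Ident P A))) \<and>
     (\<forall>X\<in>Obj P.
        left_adjoint (\<F> (X \<otimes> A)) (\<F> (X \<otimes> A \<otimes> A))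
          (\<lambda>\<alpha>. reindex P (t12 X A A) \<alpha> \<sqinter>\<^bsub>\<F> (X \<otimes> A \<otimes> A)\<^esub> reindex P (t23 X A A) \<delta>)
          (reindex P (pair (pair (pr1 P X A) (pr2 P X A)) (pr2 P X A))))"

definition is_elementary :: bool where
  "is_elementary \<longleftrightarrow> is_doctrine \<and> (\<forall>A\<in>Obj P. \<exists>\<delta>. is_equality A \<delta>)"

text \<open>\<open>\<delta>\<^sub>A\<close> is unique, being the value at \<open>\<top>\<^sub>A\<close> of the left adjoint in the first condition
  of \<open>is_equality\<close>.\<close>

definition delta :: "'o \<Rightarrow> 'p" where
  "delta A = (THE \<delta>. is_equality A \<delta>)"

text \<open>\<open>ex p\<close> is \<open>\<exists>\<^sub>p\<close>; its values on the fibre over \<open>Dom p\<close> do not depend on the choice.\<close>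

definition ex :: "'a \<Rightarrow> 'p \<Rightarrow> 'p" where
  "ex p = (SOME l. left_adjoint (\<F> (Dom P p)) (\<F> (Cod P p)) l (reindex P p))"

definition is_existential :: bool where
  "is_existential \<longleftrightarrow>
     is_doctrine \<and>
     (\<forall>p. is_projection P p \<longrightarrow>
        (\<exists>l. left_adjoint (\<F> (Dom P p)) (\<F> (Cod P p)) l (reindex P p))) \<and>
     (\<forall>p f p' f'. is_projection P p \<and> is_pullback P p f p' f' \<longrightarrow>
        (\<forall>\<beta>\<in>carrier (\<F> (Dom P p)). ex p' (reindex P f' \<beta>) = reindex P f (ex p \<beta>))) \<and>
     (\<forall>p. is_projection P p \<longrightarrow>
        (\<forall>\<alpha>\<in>carrier (\<F> (Cod P p)). \<forall>\<beta>\<in>carrier (\<F> (Dom P p)).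
           ex p (reindex P p \<alpha> \<sqinter>\<^bsub>\<F> (Dom P p)\<^esub> \<beta>) = \<alpha> \<sqinter>\<^bsub>\<F> (Cod P p)\<^esub> ex p \<beta>))"

definition is_weak_comprehension :: "'o \<Rightarrow> 'p \<Rightarrow> 'a \<Rightarrow> bool" where
  "is_weak_comprehension A \<alpha> c \<longleftrightarrow>
     c \<in> Arr P \<and> Cod P c = A \<and> reindex P c \<alpha> = \<top>\<^bsub>\<F> (Dom P c)\<^esub> \<and>
     (\<forall>Z\<in>Obj P. \<forall>f\<in>hom P Z A. reindex P f \<alpha> = \<top>\<^bsub>\<F> Z\<^esub> \<longrightarrow>
        (\<exists>g\<in>hom P Z (Dom P c). f = c \<cdot> g))"

definition has_weak_full_comprehensions :: bool where
  "has_weak_full_comprehensions \<longleftrightarrow>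
     (\<forall>A\<in>Obj P. \<forall>\<alpha>\<in>carrier (\<F> A). \<exists>c. is_weak_comprehension A \<alpha> c) \<and>
     (\<forall>A\<in>Obj P. \<forall>\<alpha>\<in>carrier (\<F> A). \<forall>\<beta>\<in>carrier (\<F> A). \<forall>c d.
        is_weak_comprehension A \<alpha> c \<and> is_weak_comprehension A \<beta> d \<and>
        (\<exists>g\<in>hom P (Dom P c) (Dom P d). c = d \<cdot> g) \<longrightarrow> \<alpha> \<sqsubseteq>\<^bsub>\<F> A\<^esub> \<beta>)"

definition is_equivalence_relation :: "'o \<Rightarrow> 'p \<Rightarrow> bool" where
  "is_equivalence_relation A \<rho> \<longleftrightarrow>
     \<rho> \<in> carrier (\<F> (A \<otimes> A)) \<and>
     delta A \<sqsubseteq>\<^bsub>\<F> (A \<otimes> A)\<^esub> \<rho> \<and>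
     \<rho> \<sqsubseteq>\<^bsub>\<F> (A \<otimes> A)\<^esub> reindex P (pair (pr2 P A A) (pr1 P A A)) \<rho> \<and>
     reindex P (t12 A A A) \<rho> \<sqinter>\<^bsub>\<F> (A \<otimes> A \<otimes> A)\<^esub> reindex P (t23 A A A) \<rho>
       \<sqsubseteq>\<^bsub>\<F> (A \<otimes> A \<otimes> A)\<^esub> reindex P (t13 A A A) \<rho>"

definition eq_obj :: "('o \<times> 'p) set" where
  "eq_obj = {(A, \<rho>). A \<in> Obj P \<and> is_equivalence_relation A \<rho>}"


subsection \<open>The elementary quotient completion\<close>

text \<open>Arrows of both categories below are triples (domain, codomain, underlying datum), since the
  same datum can represent arrows between different objects.\<close>

definition q_reps :: "'o \<times> 'p \<Rightarrow> 'o \<times> 'p \<Rightarrow> 'a set" where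
  "q_reps X Y = {f \<in> hom P (fst X) (fst Y).
     snd X \<sqsubseteq>\<^bsub>\<F> (fst X \<otimes> fst X)\<^esub> reindex P (prod_arr f f) (snd Y)}"

definition q_rel :: "'o \<times> 'p \<Rightarrow> 'o \<times> 'p \<Rightarrow> ('a \<times> 'a) set" where
  "q_rel X Y = {(f, g). f \<in> q_reps X Y \<and> g \<in> q_reps X Y \<and>
     snd X \<sqsubseteq>\<^bsub>\<F> (fst X \<otimes> fst X)\<^esub> reindex P (prod_arr f g) (snd Y)}"

definition QP :: "('o \<times> 'p, ('o \<times> 'p) \<times> ('o \<times> 'p) \<times> 'a set) cat" where
  "QP = \<lparr>
     Obj = eq_obj,
     Arr = {(X, Y, F). X \<in> eq_obj \<and> Y \<in> eq_obj \<and> F \<in> q_reps X Y // q_rel X Y},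
     Dom = (\<lambda>(X, Y, F). X),
     Cod = (\<lambda>(X, Y, F). Y),
     Ident = (\<lambda>X. (X, X, q_rel X X `` {Ident P (fst X)})),
     Comp = (\<lambda>(Y', Z, G) (X, Y, F). (X, Z, \<Union>g\<in>G. \<Union>f\<in>F. q_rel X Z `` {g \<cdot> f}))\<rparr>"


subsection \<open>The category of equivalence relations and functional relations\<close>

definition is_functional_relation :: "'o \<times> 'p \<Rightarrow> 'o \<times> 'p \<Rightarrow> 'p \<Rightarrow> bool" where
  "is_functional_relation X Y \<phi> \<longleftrightarrow>
     (let A = fst X; \<rho> = snd X; B = fst Y; \<sigma> = snd Y in
       \<phi> \<in> carrier (\<F> (A \<otimes> B)) \<and>
       reindex P (t12 A A B) \<rho> \<sqinter>\<^bsub>\<F> (A \<otimes> A \<otimes> B)\<^esub> reindex P (t23 A A B) \<phi>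
         \<sqsubseteq>\<^bsub>\<F> (A \<otimes> A \<otimes> B)\<^esub> reindex P (t13 A A B) \<phi> \<and>
       reindex P (t12 A B B) \<phi> \<sqinter>\<^bsub>\<F> (A \<otimes> B \<otimes> B)\<^esub> reindex P (t23 A B B) \<sigma>
         \<sqsubseteq>\<^bsub>\<F> (A \<otimes> B \<otimes> B)\<^esub> reindex P (t13 A B B) \<phi> \<and>
       reindex P (t12 A B B) \<phi> \<sqinter>\<^bsub>\<F> (A \<otimes> B \<otimes> B)\<^esub> reindex P (t13 A B B) \<phi>
         \<sqsubseteq>\<^bsub>\<F> (A \<otimes> B \<otimes> B)\<^esub> reindex P (t23 A B B) \<sigma> \<and>
       \<top>\<^bsub>\<F> A\<^esub> \<sqsubseteq>\<^bsub>\<F> A\<^esub> ex (pr1 P A B) \<phi>)"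

definition rel_comp :: "'o \<Rightarrow> 'o \<Rightarrow> 'o \<Rightarrow> 'p \<Rightarrow> 'p \<Rightarrow> 'p" where
  "rel_comp A B C \<psi> \<phi> =
     ex (t13 A B C) (reindex P (t12 A B C) \<phi> \<sqinter>\<^bsub>\<F> (A \<otimes> B \<otimes> C)\<^esub> reindex P (t23 A B C) \<psi>)"

definition EP :: "('o \<times> 'p, ('o \<times> 'p) \<times> ('o \<times> 'p) \<times> 'p) cat" where
  "EP = \<lparr>
     Obj = eq_obj,
     Arr = {(X, Y, \<phi>). X \<in> eq_obj \<and> Y \<in> eq_obj \<and> is_functional_relation X Y \<phi>},
     Dom = (\<lambda>(X, Y, \<phi>). X),
     Cod = (\<lambda>(X, Y, \<phi>). Y),
     Ident = (\<lambda>X. (X, X, snd X)),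
     Comp = (\<lambda>(Y', Z, \<psi>) (X, Y, \<phi>). (X, Z, rel_comp (fst X) (fst Y) (fst Z) \<psi> \<phi>))\<rparr>"


subsection \<open>The canonical functor\<close>

definition graph :: "'o \<times> 'p \<Rightarrow> 'o \<times> 'p \<Rightarrow> 'a \<Rightarrow> 'p" where
  "graph X Y f =
     (let A = fst X; \<rho> = snd X; B = fst Y; \<sigma> = snd Y in
       ex (t13 A A B)
         (reindex P (t12 A A B) \<rho> \<sqinter>\<^bsub>\<F> (A \<otimes> A \<otimes> B)\<^esub>
          reindex P (pair (f \<cdot> t2 A A B) (t3 A A B)) \<sigma>))"

text \<open>\<open>the_elem\<close> extracts the common value of \<open>graph\<close> on all representatives of a class.\<close>

definition L ::
    "('o \<times> 'p, ('o \<times> 'p) \<times> ('o \<times> 'p) \<times> 'a set,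
      'o \<times> 'p, ('o \<times> 'p) \<times> ('o \<times> 'p) \<times> 'p) func" where
  "L = \<lparr>
     on_obj = (\<lambda>X. X),
     on_arr = (\<lambda>(X, Y, F). (X, Y, the_elem (graph X Y ` F)))\<rparr>"

end

end

theory Submission
  imports Defs
begin

text \<open>Read \<open>P\<^sub>z(\<alpha>) = \<top>\<close> as \<open>\<alpha>\<close> holding at the generalized element \<open>z\<close>. With weak full comprehensions
  the order of a fibre is pointwise implication of these statements, and by Beck--Chevalley the choice
  hypothesis makes \<open>\<exists>\<close> an actual existence of generalized elements. Equivalence relations,
  functional relations, their composites and \<open>L[f]\<close> thereby become ordinary relations between generalized
  elements. A functional relation \<open>\<phi>\<close> is total at \<open>id\<^sub>A\<close>, so it is the graph of some \<open>f\<close>, and this \<open>f\<close> is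
  unique up to the target equivalence relation. Hence \<open>L\<close> is bijective on objects and on arrows.\<close>

text \<open>This reading is a Kripke--Joyal semantics. In such a semantics an existential statement
  at a stage \<open>Z\<close> is in general witnessed only after passing to a cover of
  \<open>Z\<close>. Here the choice hypothesis is assumed for every object, so it can be applied to
  \<open>Z\<close> itself, and the witness lives at the same stage. This is why composites and
  totality can be handled by first-order reasoning on the sets \<open>hom P Z A\<close>, one
  \<open>Z\<close> at a time. The order is pointwise because a weak comprehension of \<alpha> is a
  generic element satisfying \<alpha>: testing an implication there tests it everywhere. The
  obstacle is that the composites and \<open>graph\<close> quantify along \<open>t13\<close>, a leg
  of a product cone that is not a chosen one, while the choice hypothesis speaks of chosen
  projections only; a pullback connects the two. Since arrows of \<open>QP\<close> and
  \<open>EP\<close> are triples recording their ends, bijectivity on all arrows at once already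
  contains fullness and faithfulness, and \<open>L\<close> is even an isomorphism of
  categories.\<close>

section \<open>Functors bijective on objects and arrows\<close>

text \<open>The inverse bijections form a functor \<open>G\<close>, and identities serve as unit and
  counit.\<close>

lemma functor_bij_imp_equivalence:
  fixes C :: "('o, 'a, 'm) cat_scheme" and D :: "('u, 'b, 'n) cat_scheme"
  assumes F: "is_functor C D F"
    and obj: "bij_betw (on_obj F) (Obj C) (Obj D)"
    and arr: "bij_betw (on_arr F) (Arr C) (Arr D)"
  shows "is_equivalence C D F"
proof -
  interpret C: category C using F by (simp add: is_functor_def)
  interpret D: category D using F by (simp add: is_functor_def)
  define G where "G = \<lparr>on_obj = inv_into (Obj C) (on_obj F), on_arr = inv_into (Arr C) (on_arr F)\<rparr>"
  have F_obj: "on_obj F A \<in> Obj D" if "A \<in> Obj C" for A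
    using F that by (simp add: is_functor_def)
  have homD: "X \<in> Obj C \<and> Y \<in> Obj C" if "f \<in> hom C X Y" for f X Y
    using that C.dom_obj C.cod_obj by (auto simp: hom_def)
  have F_hom: "on_arr F f \<in> hom D (on_obj F X) (on_obj F Y)" if "f \<in> hom C X Y" for f X Y
    using F that homD[OF that] unfolding is_functor_def by blast
  have F_ident: "on_arr F (Ident C A) = Ident D (on_obj F A)" if "A \<in> Obj C" for A
    using F that by (simp add: is_functor_def)
  have F_comp: "on_arr F (g \<cdot>\<^bsub>C\<^esub> f) = on_arr F g \<cdot>\<^bsub>D\<^esub> on_arr F f"
    if "f \<in> hom C X Y" "g \<in> hom C Y Z" for f g X Y Z
    using F that homD[OF that(1)] homD[OF that(2)] unfolding is_functor_def by blast
  have GF_obj: "on_obj G (on_obj F A) = A" if "A \<in> Obj C" for A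
    using that obj by (simp add: G_def bij_betw_def)
  have GF_arr: "on_arr G (on_arr F f) = f" if "f \<in> Arr C" for f
    using that arr by (simp add: G_def bij_betw_def)
  have objE: "\<exists>A\<in>Obj C. B = on_obj F A" if "B \<in> Obj D" for B
    using that obj by (auto simp: bij_betw_def)
  have arrE: "\<exists>f\<in>hom C X Y. g = on_arr F f"
    if g: "g \<in> hom D (on_obj F X) (on_obj F Y)" and XY: "X \<in> Obj C" "Y \<in> Obj C" for g X Y
  proof -
    from g arr obtain f where f: "f \<in> Arr C" "g = on_arr F f"
      by (auto simp: bij_betw_def hom_def)
    \<comment> \<open>The bijection on \<open>Arr\<close> gives only some preimage \<open>f\<close>;
      injectivity on objects forces its ends to be \<open>X\<close> and \<open>Y\<close>.\<close>
    have "on_arr F f \<in> hom D (on_obj F (Dom C f)) (on_obj F (Cod C f))"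
      using f by (intro F_hom) (simp add: hom_def)
    with g f have "on_obj F (Dom C f) = on_obj F X" "on_obj F (Cod C f) = on_obj F Y"
      by (auto simp: hom_def)
    then have "Dom C f = X" "Cod C f = Y"
      using obj XY f C.dom_obj C.cod_obj by (auto simp: bij_betw_def dest: inj_onD)
    with f show ?thesis by (auto simp: hom_def)
  qed
  have G: "is_functor D C G"
    unfolding is_functor_def
  proof (intro conjI ballI)
    show "on_obj G B \<in> Obj C" if "B \<in> Obj D" for B
      using objE[OF that] GF_obj by auto
    show "on_arr G g \<in> hom C (on_obj G X) (on_obj G Y)"
      if X: "X \<in> Obj D" and Y: "Y \<in> Obj D" and g: "g \<in> hom D X Y" for X Y g
    proof -
      obtain X' Y' where XY: "X' \<in> Obj C" "Y' \<in> Obj C" "X = on_obj F X'" "Y = on_obj F Y'"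
        using objE[OF X] objE[OF Y] by blast
      with arrE[of g X' Y'] g obtain f where "f \<in> hom C X' Y'" "g = on_arr F f" by auto
      with XY show ?thesis by (simp add: GF_obj GF_arr hom_def)
    qed
    show "on_arr G (Ident D B) = Ident C (on_obj G B)" if B: "B \<in> Obj D" for B
    proof -
      obtain A where A: "A \<in> Obj C" "B = on_obj F A" using objE[OF B] by blast
      have "Ident C A \<in> Arr C" using C.ident_hom[OF A(1)] by (simp add: hom_def)
      with A show ?thesis by (metis F_ident GF_arr GF_obj)
    qed
    show "on_arr G (g \<cdot>\<^bsub>D\<^esub> f) = on_arr G g \<cdot>\<^bsub>C\<^esub> on_arr G f"
      if X: "X \<in> Obj D" and Y: "Y \<in> Obj D" and Z: "Z \<in> Obj D"
        and fg: "f \<in> hom D X Y" "g \<in> hom D Y Z" for X Y Z f g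
    proof -
      obtain X' Y' Z' where XYZ: "X' \<in> Obj C" "Y' \<in> Obj C" "Z' \<in> Obj C"
        "X = on_obj F X'" "Y = on_obj F Y'" "Z = on_obj F Z'"
        using objE[OF X] objE[OF Y] objE[OF Z] by blast
      obtain f' where f': "f' \<in> hom C X' Y'" "f = on_arr F f'"
        using arrE[of f X' Y'] fg XYZ by auto
      obtain g' where g': "g' \<in> hom C Y' Z'" "g = on_arr F g'"
        using arrE[of g Y' Z'] fg XYZ by auto
      have "g' \<cdot>\<^bsub>C\<^esub> f' \<in> Arr C" using C.comp_hom[OF f'(1) g'(1)] by (simp add: hom_def)
      then have "on_arr G (on_arr F (g' \<cdot>\<^bsub>C\<^esub> f')) = g' \<cdot>\<^bsub>C\<^esub> f'" by (rule GF_arr)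
      moreover have "f' \<in> Arr C" "g' \<in> Arr C" using f' g' by (simp_all add: hom_def)
      ultimately show ?thesis using F_comp[OF f'(1) g'(1)] f' g' GF_arr by simp
    qed
  qed unfold_locales
  have FG_obj: "on_obj F (on_obj G B) = B" if "B \<in> Obj D" for B
    using objE[OF that] GF_obj by auto
  have FG_arr: "on_arr F (on_arr G g) = g" if "g \<in> Arr D" for g
    using that arr by (simp add: G_def bij_betw_def f_inv_into_f)
  have iso_ident: "is_iso E (Ident E A)" if "category E" "A \<in> Obj E"
    for E :: "('v, 'c, 'k) cat_scheme" and A
  proof -
    interpret E: category E by fact
    have i: "Ident E A \<in> hom E A A" using that by (simp add: E.ident_hom)
    then show ?thesis using E.ident_left[OF i] by (auto simp: is_iso_def hom_def)
  qed
  \<comment> \<open>\<open>comp_func G F\<close> may differ from \<open>id_func\<close> outside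
    \<open>Obj C\<close> and \<open>Arr C\<close>, so the records need not be equal; they agree on
    all that naturality sees.\<close>
  have "is_natural_iso C C id_func (comp_func G F) (Ident C)"
    unfolding is_natural_iso_def
    using GF_obj GF_arr C.ident_hom C.ident_left C.ident_right iso_ident[OF C.category_axioms]
    by (auto simp: id_func_def comp_func_def hom_def)
  moreover have "is_natural_iso D D (comp_func F G) id_func (Ident D)"
    unfolding is_natural_iso_def
    using FG_obj FG_arr D.ident_hom D.ident_left D.ident_right iso_ident[OF D.category_axioms]
    by (auto simp: id_func_def comp_func_def hom_def)
  ultimately show ?thesis
    unfolding is_equivalence_def using F G by blast
qed

section \<open>Products and fibres\<close>

locale product_doctrine =
  fixes P :: "('o, 'a, 'p) doctrine" (structure)
  assumes doctrine: "is_doctrine P"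
begin

sublocale category P
  using doctrine by (simp add: is_doctrine_def)

lemma arr_hom: "f \<in> Arr P \<Longrightarrow> f \<in> hom P (Dom P f) (Cod P f)"
  by (simp add: hom_def)

lemma hom_obj: "f \<in> hom P A B \<Longrightarrow> A \<in> Obj P \<and> B \<in> Obj P"
  using dom_obj cod_obj by (auto simp: hom_def)

lemma ident_arr [simp]:
  "A \<in> Obj P \<Longrightarrow> Ident P A \<in> Arr P"
  "A \<in> Obj P \<Longrightarrow> Dom P (Ident P A) = A"
  "A \<in> Obj P \<Longrightarrow> Cod P (Ident P A) = A"
  using ident_hom by (auto simp: hom_def)

text \<open>Arrows are typed by equations for \<open>Dom\<close> and \<open>Cod\<close>: these can
  be computed by rewriting, whereas \<open>comp_hom\<close> would require the intermediate object to
  be guessed.\<close>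

lemma comp_arr [simp]:
  assumes "f \<in> Arr P" "g \<in> Arr P" "Dom P g = Cod P f"
  shows "g \<cdot> f \<in> Arr P" "Dom P (g \<cdot> f) = Dom P f" "Cod P (g \<cdot> f) = Cod P g"
  using comp_hom[OF arr_hom[OF assms(1)], of g "Cod P g"] assms by (auto simp: hom_def)

text \<open>Right-nested composites are the normal form. The object equations are premises so that
  the identity laws also fire when \<open>A\<close> is not literally \<open>Dom P f\<close> or
  \<open>Cod P f\<close>.\<close>

lemma comp_simps [simp]:
  "f \<in> Arr P \<Longrightarrow> A = Dom P f \<Longrightarrow> f \<cdot> Ident P A = f"
  "f \<in> Arr P \<Longrightarrow> A = Cod P f \<Longrightarrow> Ident P A \<cdot> f = f"
  "\<lbrakk>f \<in> Arr P; g \<in> Arr P; h \<in> Arr P; Dom P g = Cod P f; Dom P h = Cod P g\<rbrakk>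
     \<Longrightarrow> (h \<cdot> g) \<cdot> f = h \<cdot> (g \<cdot> f)"
  using ident_right ident_left comp_assoc[of f "Dom P f" "Cod P f" g "Cod P g" h "Cod P h"]
  by (auto simp: hom_def)

lemma product: "\<lbrakk>A \<in> Obj P; B \<in> Obj P\<rbrakk> \<Longrightarrow> is_product P A B (A \<otimes> B) (pr1 P A B) (pr2 P A B)"
  using doctrine by (simp add: is_doctrine_def)

lemma projection_arr [simp]:
  assumes "A \<in> Obj P" "B \<in> Obj P"
  shows "pr1 P A B \<in> Arr P" "Dom P (pr1 P A B) = A \<otimes> B" "Cod P (pr1 P A B) = A"
    and "pr2 P A B \<in> Arr P" "Dom P (pr2 P A B) = A \<otimes> B" "Cod P (pr2 P A B) = B"
  using product[OF assms] by (auto simp: is_product_def hom_def)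

lemma prod_obj [simp]: "\<lbrakk>A \<in> Obj P; B \<in> Obj P\<rbrakk> \<Longrightarrow> A \<otimes> B \<in> Obj P"
  using projection_arr(1,2) dom_obj by metis

declare dom_obj [simp] cod_obj [simp]

lemma pair_ex1:
  assumes "f \<in> Arr P" "g \<in> Arr P" "Dom P f = Dom P g"
  shows "\<exists>!h. h \<in> hom P (Dom P f) (Cod P f \<otimes> Cod P g) \<and>
    pr1 P (Cod P f) (Cod P g) \<cdot> h = f \<and> pr2 P (Cod P f) (Cod P g) \<cdot> h = g"
  using product[of "Cod P f" "Cod P g"] assms by (auto simp: is_product_def hom_def)

lemma pair_arr [simp]:
  assumes "f \<in> Arr P" "g \<in> Arr P" "Dom P f = Dom P g"
  shows "pair P f g \<in> Arr P" "Dom P (pair P f g) = Dom P g" "Cod P (pair P f g) = Cod P f \<otimes> Cod P g"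
  using theI'[OF pair_ex1[OF assms]] assms unfolding pair_def hom_def by auto

lemma pr_pair [simp]:
  assumes "f \<in> Arr P" "g \<in> Arr P" "Dom P f = Dom P g" "Cod P f = A" "Cod P g = B"
  shows "pr1 P A B \<cdot> pair P f g = f" "pr2 P A B \<cdot> pair P f g = g"
  using theI'[OF pair_ex1[OF assms(1-3)]] assms unfolding pair_def by auto

lemma pair_unique:
  assumes "h \<in> hom P Z (A \<otimes> B)" "A \<in> Obj P" "B \<in> Obj P"
  shows "pair P (pr1 P A B \<cdot> h) (pr2 P A B \<cdot> h) = h"
proof -
  let ?f = "pr1 P A B \<cdot> h" and ?g = "pr2 P A B \<cdot> h"
  have fg: "?f \<in> Arr P" "?g \<in> Arr P" "Dom P ?f = Z" "Dom P ?g = Z" "Cod P ?f = A" "Cod P ?g = B"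
    using assms by (auto simp: hom_def)
  have "pair P ?f ?g \<in> hom P Z (A \<otimes> B) \<and> pr1 P A B \<cdot> pair P ?f ?g = ?f \<and> pr2 P A B \<cdot> pair P ?f ?g = ?g"
    using fg by (auto simp del: comp_simps simp: hom_def)
  moreover have "\<exists>!k. k \<in> hom P Z (A \<otimes> B) \<and> pr1 P A B \<cdot> k = ?f \<and> pr2 P A B \<cdot> k = ?g"
    using pair_ex1[of ?f ?g] unfolding fg by (simp add: fg(1,2))
  ultimately show ?thesis using assms(1) by blast
qed

text \<open>Right nesting hides the redex of a projection applied to \<open>pair P f g\<close>, so
  associativity is reversed in this proof.\<close>

lemma pair_comp [simp]:
  assumes "f \<in> Arr P" "g \<in> Arr P" "h \<in> Arr P" "Dom P f = Cod P h" "Dom P g = Cod P h"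
  shows "pair P f g \<cdot> h = pair P (f \<cdot> h) (g \<cdot> h)"
  using pair_unique[of "pair P f g \<cdot> h" "Dom P h" "Cod P f" "Cod P g"] assms
  by (simp add: hom_def flip: comp_simps(3))

lemma pair_eq_iff:
  assumes "f \<in> hom P Z A" "g \<in> hom P Z B" "f' \<in> hom P Z A" "g' \<in> hom P Z B"
  shows "pair P f g = pair P f' g' \<longleftrightarrow> f = f' \<and> g = g'"
proof -
  have "pr1 P A B \<cdot> pair P f g = f" "pr2 P A B \<cdot> pair P f g = g"
    "pr1 P A B \<cdot> pair P f' g' = f'" "pr2 P A B \<cdot> pair P f' g' = g'"
    using assms by (auto simp: hom_def)
  then show ?thesis by metis
qed

text \<open>Turns one quantifier over elements of a product into two over elements of its
  factors.\<close>

lemma elem_pairE: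
  assumes "z \<in> hom P Z (A \<otimes> B)" "A \<in> Obj P" "B \<in> Obj P"
  obtains a b where "a \<in> hom P Z A" "b \<in> hom P Z B" "z = pair P a b"
  using pair_unique[OF assms] assms that[of "pr1 P A B \<cdot> z" "pr2 P A B \<cdot> z"]
  by (auto simp: hom_def)

lemma prod_arr_arr [simp]:
  assumes "f \<in> Arr P" "g \<in> Arr P"
  shows "prod_arr P f g \<in> Arr P" "Dom P (prod_arr P f g) = Dom P f \<otimes> Dom P g"
    "Cod P (prod_arr P f g) = Cod P f \<otimes> Cod P g"
  using assms by (auto simp: prod_arr_def)

lemma prod_arr_pair [simp]:
  assumes "f \<in> Arr P" "g \<in> Arr P" "a \<in> Arr P" "b \<in> Arr P" "Dom P a = Dom P b"
    "Cod P a = Dom P f" "Cod P b = Dom P g"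
  shows "prod_arr P f g \<cdot> pair P a b = pair P (f \<cdot> a) (g \<cdot> b)"
  using assms by (simp add: prod_arr_def)

lemma triple_arr [simp]:
  assumes "A \<in> Obj P" "B \<in> Obj P" "C \<in> Obj P"
  shows "t1 P A B C \<in> Arr P" "Dom P (t1 P A B C) = A \<otimes> B \<otimes> C" "Cod P (t1 P A B C) = A"
    "t2 P A B C \<in> Arr P" "Dom P (t2 P A B C) = A \<otimes> B \<otimes> C" "Cod P (t2 P A B C) = B"
    "t3 P A B C \<in> Arr P" "Dom P (t3 P A B C) = A \<otimes> B \<otimes> C" "Cod P (t3 P A B C) = C"
    "t12 P A B C \<in> Arr P" "Dom P (t12 P A B C) = A \<otimes> B \<otimes> C" "Cod P (t12 P A B C) = A \<otimes> B"
    "t13 P A B C \<in> Arr P" "Dom P (t13 P A B C) = A \<otimes> B \<otimes> C" "Cod P (t13 P A B C) = A \<otimes> C"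
    "t23 P A B C \<in> Arr P" "Dom P (t23 P A B C) = A \<otimes> B \<otimes> C" "Cod P (t23 P A B C) = B \<otimes> C"
  using assms by (auto simp: t1_def t2_def t3_def t12_def t13_def t23_def)

lemma triple_pair [simp]:
  assumes "a \<in> Arr P" "b \<in> Arr P" "c \<in> Arr P" "Dom P a = Dom P c" "Dom P b = Dom P c"
    "Cod P a = A" "Cod P b = B" "Cod P c = C"
  shows "t1 P A B C \<cdot> pair P (pair P a b) c = a"
    "t2 P A B C \<cdot> pair P (pair P a b) c = b"
    "t3 P A B C \<cdot> pair P (pair P a b) c = c"
    "t12 P A B C \<cdot> pair P (pair P a b) c = pair P a b"
    "t13 P A B C \<cdot> pair P (pair P a b) c = pair P a c"
    "t23 P A B C \<cdot> pair P (pair P a b) c = pair P b c"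
proof -
  have *: "A \<in> Obj P" "B \<in> Obj P" "C \<in> Obj P" using assms by auto
  show 1: "t1 P A B C \<cdot> pair P (pair P a b) c = a"
    "t2 P A B C \<cdot> pair P (pair P a b) c = b"
    "t3 P A B C \<cdot> pair P (pair P a b) c = c"
    using assms * by (simp_all add: t1_def t2_def t3_def)
  show "t12 P A B C \<cdot> pair P (pair P a b) c = pair P a b"
    "t13 P A B C \<cdot> pair P (pair P a b) c = pair P a c"
    "t23 P A B C \<cdot> pair P (pair P a b) c = pair P b c"
    using assms * 1 by (simp_all add: t12_def t13_def t23_def)
qed

text \<open>Rearranging the factors presents the triple product as a product of
  \<open>A \<otimes> C\<close> and \<open>B\<close>, with complementary leg \<open>t2\<close>. This
  makes \<open>t13\<close> a projection along which \<open>ex\<close> is an adjoint.\<close>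

lemma t13_product:
  assumes "A \<in> Obj P" "B \<in> Obj P" "C \<in> Obj P"
  shows "is_product P (A \<otimes> C) B (A \<otimes> B \<otimes> C) (t13 P A B C) (t2 P A B C)"
  unfolding is_product_def
proof (intro conjI ballI)
  fix Z f g assume Z: "Z \<in> Obj P" and f: "f \<in> hom P Z (A \<otimes> C)" and g: "g \<in> hom P Z B"
  obtain a c where ac: "a \<in> hom P Z A" "c \<in> hom P Z C" "f = pair P a c"
    using elem_pairE[OF f] assms by blast
  show "\<exists>!h. h \<in> hom P Z (A \<otimes> B \<otimes> C) \<and> t13 P A B C \<cdot> h = f \<and> t2 P A B C \<cdot> h = g"
  proof (rule ex1I[of _ "pair P (pair P a g) c"])
    show "pair P (pair P a g) c \<in> hom P Z (A \<otimes> B \<otimes> C) \<and>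
        t13 P A B C \<cdot> pair P (pair P a g) c = f \<and> t2 P A B C \<cdot> pair P (pair P a g) c = g"
      using ac g by (auto simp: hom_def)
  next
    fix h assume h: "h \<in> hom P Z (A \<otimes> B \<otimes> C) \<and> t13 P A B C \<cdot> h = f \<and> t2 P A B C \<cdot> h = g"
    obtain x c' where x: "x \<in> hom P Z (A \<otimes> B)" "c' \<in> hom P Z C" "h = pair P x c'"
      using elem_pairE[of h Z "A \<otimes> B" C] h assms by auto
    obtain a' b' where y: "a' \<in> hom P Z A" "b' \<in> hom P Z B" "x = pair P a' b'"
      using elem_pairE[OF x(1)] assms by auto
    have "pair P a' c' = pair P a c" "b' = g"
      using h x y ac by (auto simp: hom_def)
    moreover from this(1) have "a' = a" "c' = c"
      using pair_eq_iff[OF y(1) x(2) ac(1,2)] by auto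
    ultimately show "h = pair P (pair P a g) c"
      using x y by simp
  qed
qed (use assms in \<open>auto simp: hom_def\<close>)

text \<open>The arrow \<open>h\<close> is the product of \<open>z\<close> with the identity of
  \<open>B\<close>, taken into an arbitrary cone. The pullback replaces the leg \<open>p\<close> by
  a chosen projection over \<open>Z\<close>.\<close>

lemma pullback_product:
  assumes X: "is_product P A B X p q" and z: "z \<in> hom P Z A" and h: "h \<in> hom P (Z \<otimes> B) X"
    and ph: "p \<cdot> h = z \<cdot> pr1 P Z B" and qh: "q \<cdot> h = pr2 P Z B"
  shows "is_pullback P p z (pr1 P Z B) h"
proof -
  have pq: "p \<in> hom P X A" "q \<in> hom P X B" using X by (auto simp: is_product_def)
  have ZB: "Z \<in> Obj P" "B \<in> Obj P" using z pq hom_obj by auto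
  have "\<exists>!k. k \<in> hom P W (Z \<otimes> B) \<and> pr1 P Z B \<cdot> k = u \<and> h \<cdot> k = v"
    if W: "W \<in> Obj P" and u: "u \<in> hom P W Z" and v: "v \<in> hom P W X" and e: "p \<cdot> v = z \<cdot> u" for W u v
  \<comment> \<open>The witness is forced: the second component of a mediating \<open>k\<close> is
    \<open>q \<cdot> h \<cdot> k = q \<cdot> v\<close>.\<close>
  proof (rule ex1I[of _ "pair P u (q \<cdot> v)"])
    let ?k = "pair P u (q \<cdot> v)"
    have k: "?k \<in> hom P W (Z \<otimes> B)" "pr1 P Z B \<cdot> ?k = u" "pr2 P Z B \<cdot> ?k = q \<cdot> v"
      using u v pq by (auto simp: hom_def)
    have "p \<cdot> (h \<cdot> ?k) = (p \<cdot> h) \<cdot> ?k" "q \<cdot> (h \<cdot> ?k) = (q \<cdot> h) \<cdot> ?k"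
      using pq h k(1) by (simp_all add: hom_def)
    then have "p \<cdot> (h \<cdot> ?k) = p \<cdot> v" "q \<cdot> (h \<cdot> ?k) = q \<cdot> v"
      using k ph qh e z ZB by (simp_all add: hom_def)
    moreover have "h \<cdot> ?k \<in> hom P W X" using h k(1) comp_hom by blast
    moreover have "p \<cdot> v \<in> hom P W A" "q \<cdot> v \<in> hom P W B" using v pq comp_hom by blast+
    ultimately have "h \<cdot> ?k = v"
      using X v W unfolding is_product_def by metis
    with k show "?k \<in> hom P W (Z \<otimes> B) \<and> pr1 P Z B \<cdot> ?k = u \<and> h \<cdot> ?k = v" by simp
  next
    fix k assume k: "k \<in> hom P W (Z \<otimes> B) \<and> pr1 P Z B \<cdot> k = u \<and> h \<cdot> k = v"
    have "q \<cdot> v = (q \<cdot> h) \<cdot> k" using k pq h by (auto simp: hom_def)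
    with qh have "q \<cdot> v = pr2 P Z B \<cdot> k" by simp
    with k show "k = pair P u (q \<cdot> v)" using pair_unique[of k W Z B] ZB by simp
  qed
  moreover have "Dom P p = X" "Dom P z = Z" "Dom P (pr1 P Z B) = Z \<otimes> B"
    using z pq ZB by (auto simp: hom_def)
  moreover have "p \<in> Arr P" "z \<in> Arr P" "Cod P p = Cod P z" "pr1 P Z B \<in> hom P (Z \<otimes> B) Z"
    using z pq ZB by (auto simp: hom_def)
  ultimately show ?thesis
    using h ph by (simp add: is_pullback_def)
qed

section \<open>Fibres and reindexing\<close>

lemma inf_semilattice_fibre: "A \<in> Obj P \<Longrightarrow> inf_semilattice (\<F> A)"
  using doctrine by (simp add: is_doctrine_def)

lemma partial_order_fibre: "A \<in> Obj P \<Longrightarrow> partial_order (\<F> A)"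
  using inf_semilattice_fibre by (auto simp: inf_semilattice_def lower_semilattice_def)

lemma fibre_closed [simp]:
  assumes "A \<in> Obj P"
  shows "\<top>\<^bsub>\<F> A\<^esub> \<in> carrier (\<F> A)"
    and "\<lbrakk>\<alpha> \<in> carrier (\<F> A); \<beta> \<in> carrier (\<F> A)\<rbrakk> \<Longrightarrow> \<alpha> \<sqinter>\<^bsub>\<F> A\<^esub> \<beta> \<in> carrier (\<F> A)"
proof -
  interpret inf_semilattice "\<F> A" using assms by (rule inf_semilattice_fibre)
  show "\<top>\<^bsub>\<F> A\<^esub> \<in> carrier (\<F> A)"
    and "\<lbrakk>\<alpha> \<in> carrier (\<F> A); \<beta> \<in> carrier (\<F> A)\<rbrakk> \<Longrightarrow> \<alpha> \<sqinter>\<^bsub>\<F> A\<^esub> \<beta> \<in> carrier (\<F> A)"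
    by simp_all
qed

lemma top_le_iff:
  assumes "A \<in> Obj P" "\<alpha> \<in> carrier (\<F> A)"
  shows "\<top>\<^bsub>\<F> A\<^esub> \<sqsubseteq>\<^bsub>\<F> A\<^esub> \<alpha> \<longleftrightarrow> \<alpha> = \<top>\<^bsub>\<F> A\<^esub>"
proof -
  interpret inf_semilattice "\<F> A" using assms(1) by (rule inf_semilattice_fibre)
  show ?thesis using assms le_antisym by auto
qed

lemma meet_eq_top_iff:
  assumes "A \<in> Obj P" "\<alpha> \<in> carrier (\<F> A)" "\<beta> \<in> carrier (\<F> A)"
  shows "\<alpha> \<sqinter>\<^bsub>\<F> A\<^esub> \<beta> = \<top>\<^bsub>\<F> A\<^esub> \<longleftrightarrow> \<alpha> = \<top>\<^bsub>\<F> A\<^esub> \<and> \<beta> = \<top>\<^bsub>\<F> A\<^esub>"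
proof -
  interpret inf_semilattice "\<F> A" using assms(1) by (rule inf_semilattice_fibre)
  show ?thesis
    using assms meet_left[of \<alpha> \<beta>] meet_right[of \<alpha> \<beta>] meet_le[of "\<top>\<^bsub>\<F> A\<^esub>" \<alpha> \<beta>]
      top_le_iff[OF assms(1)] by auto
qed

lemma top_meet:
  assumes "A \<in> Obj P" "\<alpha> \<in> carrier (\<F> A)"
  shows "\<top>\<^bsub>\<F> A\<^esub> \<sqinter>\<^bsub>\<F> A\<^esub> \<alpha> = \<alpha>"
proof -
  interpret inf_semilattice "\<F> A" using assms(1) by (rule inf_semilattice_fibre)
  show ?thesis
    using assms meet_right[of "\<top>\<^bsub>\<F> A\<^esub>" \<alpha>] meet_le[of \<alpha> "\<top>\<^bsub>\<F> A\<^esub>" \<alpha>] le_antisym by auto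
qed

lemma reindex_hom: "f \<in> Arr P \<Longrightarrow> inf_hom (\<F> (Cod P f)) (\<F> (Dom P f)) (reindex P f)"
  using doctrine arr_hom by (simp add: is_doctrine_def)

lemma reindex_closed [simp]:
  assumes "f \<in> Arr P" "\<alpha> \<in> carrier (\<F> (Cod P f))" "A = Dom P f"
  shows "reindex P f \<alpha> \<in> carrier (\<F> A)"
  using reindex_hom[of f] assms by (auto simp: inf_hom_def)

lemma reindex_comp:
  assumes "f \<in> Arr P" "g \<in> Arr P" "Dom P g = Cod P f" "\<alpha> \<in> carrier (\<F> (Cod P g))"
  shows "reindex P (g \<cdot> f) \<alpha> = reindex P f (reindex P g \<alpha>)"
proof -
  have "f \<in> hom P (Dom P f) (Cod P f)" "g \<in> hom P (Cod P f) (Cod P g)"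
    using assms by (auto simp: hom_def)
  then show ?thesis
    using doctrine assms(4) hom_obj unfolding is_doctrine_def by meson
qed

section \<open>Validity at generalized elements\<close>

text \<open>Equality with the top is the form used in \<open>is_weak_comprehension\<close>, so a
  weak comprehension of \<alpha> is an element satisfying \<alpha> through which all others factor.
  The stage is read off as \<open>Dom P z\<close>.\<close>

definition sat :: "'p \<Rightarrow> 'a \<Rightarrow> bool" where
  "sat \<alpha> z \<longleftrightarrow> reindex P z \<alpha> = \<top>\<^bsub>\<F> (Dom P z)\<^esub>"

lemma sat_reindex [simp]:
  assumes "f \<in> Arr P" "z \<in> Arr P" "Cod P z = Dom P f" "\<alpha> \<in> carrier (\<F> (Cod P f))"
  shows "sat (reindex P f \<alpha>) z \<longleftrightarrow> sat \<alpha> (f \<cdot> z)"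
  using assms by (simp add: sat_def reindex_comp)

text \<open>Stability under change of stage, because reindexing preserves the top.\<close>

lemma sat_comp:
  assumes "z \<in> Arr P" "f \<in> Arr P" "Cod P f = Dom P z" "\<alpha> \<in> carrier (\<F> (Cod P z))" "sat \<alpha> z"
  shows "sat \<alpha> (z \<cdot> f)"
  using assms reindex_hom[of f] by (simp add: sat_def reindex_comp inf_hom_def)

lemma sat_meet [simp]:
  assumes "z \<in> Arr P" "Cod P z = A" "\<alpha> \<in> carrier (\<F> A)" "\<beta> \<in> carrier (\<F> A)"
  shows "sat (\<alpha> \<sqinter>\<^bsub>\<F> A\<^esub> \<beta>) z \<longleftrightarrow> sat \<alpha> z \<and> sat \<beta> z"
proof -
  have "reindex P z (\<alpha> \<sqinter>\<^bsub>\<F> A\<^esub> \<beta>) = reindex P z \<alpha> \<sqinter>\<^bsub>\<F> (Dom P z)\<^esub> reindex P z \<beta>"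
    using reindex_hom[of z] assms by (auto simp: inf_hom_def)
  then show ?thesis using assms by (auto simp: sat_def meet_eq_top_iff)
qed

lemma sat_top [simp]: "z \<in> Arr P \<Longrightarrow> Cod P z = A \<Longrightarrow> sat \<top>\<^bsub>\<F> A\<^esub> z"
  using reindex_hom[of z] by (auto simp: sat_def inf_hom_def)

text \<open>\<open>inf_hom\<close> speaks of meets and top only; monotonicity is recovered by
  writing the inequality as \<alpha> \<sqinter> \<beta> = \<alpha>.\<close>

lemma sat_mono:
  assumes "z \<in> Arr P" "Cod P z = A" "\<alpha> \<in> carrier (\<F> A)" "\<beta> \<in> carrier (\<F> A)"
    "\<alpha> \<sqsubseteq>\<^bsub>\<F> A\<^esub> \<beta>" "sat \<alpha> z"
  shows "sat \<beta> z"
proof -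
  have A: "A \<in> Obj P" using assms by auto
  interpret inf_semilattice "\<F> A" using A by (rule inf_semilattice_fibre)
  have "\<alpha> \<sqinter>\<^bsub>\<F> A\<^esub> \<beta> = \<alpha>"
    using assms meet_left[of \<alpha> \<beta>] meet_le[of \<alpha> \<alpha> \<beta>] le_antisym by auto
  then show ?thesis using assms sat_meet[of z A \<alpha> \<beta>] by simp
qed

end

section \<open>Order, existential quantifier and equality at generalized elements\<close>

locale choice_doctrine = product_doctrine P
  for P :: "('o, 'a, 'p) doctrine" (structure) +
  assumes elementary: "is_elementary P"
    and existential: "is_existential P"
    and comprehensions: "has_weak_full_comprehensions P"
    and choice: "\<lbrakk>A \<in> Obj P; B \<in> Obj P; \<alpha> \<in> carrier (\<F> (A \<otimes> B));
        \<top>\<^bsub>\<F> A\<^esub> \<sqsubseteq>\<^bsub>\<F> A\<^esub> ex P (pr1 P A B) \<alpha>\<rbrakk>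
      \<Longrightarrow> \<exists>w\<in>hom P A B. \<top>\<^bsub>\<F> A\<^esub> \<sqsubseteq>\<^bsub>\<F> A\<^esub> reindex P (pair P (Ident P A) w) \<alpha>"
begin

abbreviation rel :: "'p \<Rightarrow> 'a \<Rightarrow> 'a \<Rightarrow> bool" where
  "rel \<alpha> a b \<equiv> sat \<alpha> (pair P a b)"

text \<open>For the converse, take weak comprehensions \<open>c\<close> of \<alpha> and
  \<open>d\<close> of \<beta>. As \<alpha> holds at \<open>c\<close>, so does \<beta>; hence
  \<open>c\<close> factors through \<open>d\<close>, and fullness gives the inequality.\<close>

lemma le_iff_sat:
  assumes "A \<in> Obj P" "\<alpha> \<in> carrier (\<F> A)" "\<beta> \<in> carrier (\<F> A)"
  shows "\<alpha> \<sqsubseteq>\<^bsub>\<F> A\<^esub> \<beta> \<longleftrightarrow> (\<forall>Z. \<forall>z\<in>hom P Z A. sat \<alpha> z \<longrightarrow> sat \<beta> z)"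
proof
  assume "\<alpha> \<sqsubseteq>\<^bsub>\<F> A\<^esub> \<beta>"
  then show "\<forall>Z. \<forall>z\<in>hom P Z A. sat \<alpha> z \<longrightarrow> sat \<beta> z"
    using assms sat_mono by (auto simp: hom_def)
next
  assume *: "\<forall>Z. \<forall>z\<in>hom P Z A. sat \<alpha> z \<longrightarrow> sat \<beta> z"
  obtain c d where c: "is_weak_comprehension P A \<alpha> c" and d: "is_weak_comprehension P A \<beta> d"
    using comprehensions assms unfolding has_weak_full_comprehensions_def by meson
  have "c \<in> hom P (Dom P c) A" "sat \<alpha> c"
    using c by (auto simp: is_weak_comprehension_def hom_def sat_def)
  moreover from this * have "sat \<beta> c" by blast
  ultimately have "\<exists>g\<in>hom P (Dom P c) (Dom P d). c = d \<cdot> g"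
    using d hom_obj unfolding is_weak_comprehension_def sat_def by blast
  then show "\<alpha> \<sqsubseteq>\<^bsub>\<F> A\<^esub> \<beta>"
    using comprehensions assms c d unfolding has_weak_full_comprehensions_def by blast
qed

lemma le_iff_rel:
  assumes "A \<in> Obj P" "B \<in> Obj P" "\<alpha> \<in> carrier (\<F> (A \<otimes> B))" "\<beta> \<in> carrier (\<F> (A \<otimes> B))"
  shows "\<alpha> \<sqsubseteq>\<^bsub>\<F> (A \<otimes> B)\<^esub> \<beta> \<longleftrightarrow>
    (\<forall>Z. \<forall>a\<in>hom P Z A. \<forall>b\<in>hom P Z B. rel \<alpha> a b \<longrightarrow> rel \<beta> a b)"
proof -
  have "(\<forall>z\<in>hom P Z (A \<otimes> B). sat \<alpha> z \<longrightarrow> sat \<beta> z) \<longleftrightarrow>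
      (\<forall>a\<in>hom P Z A. \<forall>b\<in>hom P Z B. rel \<alpha> a b \<longrightarrow> rel \<beta> a b)" for Z
  proof -
    have "pair P a b \<in> hom P Z (A \<otimes> B)" if "a \<in> hom P Z A" "b \<in> hom P Z B" for a b
      using that by (auto simp: hom_def)
    then show ?thesis using assms elem_pairE by metis
  qed
  then show ?thesis using assms by (simp add: le_iff_sat)
qed

lemma le_iff_rel3:
  assumes "A \<in> Obj P" "B \<in> Obj P" "C \<in> Obj P"
    "\<alpha> \<in> carrier (\<F> (A \<otimes> B \<otimes> C))" "\<beta> \<in> carrier (\<F> (A \<otimes> B \<otimes> C))"
  shows "\<alpha> \<sqsubseteq>\<^bsub>\<F> (A \<otimes> B \<otimes> C)\<^esub> \<beta> \<longleftrightarrow>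
    (\<forall>Z. \<forall>a\<in>hom P Z A. \<forall>b\<in>hom P Z B. \<forall>c\<in>hom P Z C.
      rel \<alpha> (pair P a b) c \<longrightarrow> rel \<beta> (pair P a b) c)"
proof -
  have "(\<forall>x\<in>hom P Z (A \<otimes> B). \<forall>c\<in>hom P Z C. rel \<alpha> x c \<longrightarrow> rel \<beta> x c) \<longleftrightarrow>
      (\<forall>a\<in>hom P Z A. \<forall>b\<in>hom P Z B. \<forall>c\<in>hom P Z C.
        rel \<alpha> (pair P a b) c \<longrightarrow> rel \<beta> (pair P a b) c)" for Z
  proof -
    have "pair P a b \<in> hom P Z (A \<otimes> B)" if "a \<in> hom P Z A" "b \<in> hom P Z B" for a b
      using that by (auto simp: hom_def)
    then show ?thesis using assms elem_pairE[of _ Z A B] by metis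
  qed
  then show ?thesis using assms by (simp add: le_iff_rel)
qed

text \<open>Extensionality: it reduces the category laws of \<open>EP\<close> and the functoriality
  of \<open>L\<close> to statements about elements. The fibres are partial orders in the strict
  sense, so antisymmetry yields equality.\<close>

lemma eq_rel:
  assumes "A \<in> Obj P" "B \<in> Obj P" "\<alpha> \<in> carrier (\<F> (A \<otimes> B))" "\<beta> \<in> carrier (\<F> (A \<otimes> B))"
    and "\<And>Z a b. \<lbrakk>a \<in> hom P Z A; b \<in> hom P Z B\<rbrakk> \<Longrightarrow> rel \<alpha> a b \<longleftrightarrow> rel \<beta> a b"
  shows "\<alpha> = \<beta>"
proof -
  interpret partial_order "\<F> (A \<otimes> B)" using assms by (simp add: partial_order_fibre)
  show ?thesis using assms by (intro le_antisym) (simp_all add: le_iff_rel)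
qed

lemma left_adjoint_ex:
  assumes "is_projection P p"
  shows "left_adjoint (\<F> (Dom P p)) (\<F> (Cod P p)) (ex P p) (reindex P p)"
proof -
  have "\<exists>l. left_adjoint (\<F> (Dom P p)) (\<F> (Cod P p)) l (reindex P p)"
    using existential assms by (simp add: is_existential_def)
  then show ?thesis unfolding ex_def by (rule someI_ex)
qed

lemma ex_closed:
  assumes "is_projection P p" "\<alpha> \<in> carrier (\<F> (Dom P p))"
  shows "ex P p \<alpha> \<in> carrier (\<F> (Cod P p))"
  using left_adjoint_ex[OF assms(1)] assms(2)
  by (auto simp: left_adjoint_def galois_connection_def connection_def)

lemma ex_unit:
  assumes "is_projection P p" "\<alpha> \<in> carrier (\<F> (Dom P p))"
  shows "\<alpha> \<sqsubseteq>\<^bsub>\<F> (Dom P p)\<^esub> reindex P p (ex P p \<alpha>)"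
  using galois_connection.inflation[OF left_adjoint_ex[OF assms(1), unfolded left_adjoint_def]] assms(2)
  by simp

text \<open>Beck--Chevalley reduces \<open>\<exists>\<^sub>p\<close> at the stage \<open>z : Z \<rightarrow> A\<close> to a chosen projection
  \<open>Z \<times> B \<rightarrow> Z\<close>, where the choice hypothesis provides a witness.\<close>

lemma sat_ex_iff:
  assumes X: "is_product P A B X p q" and \<alpha>: "\<alpha> \<in> carrier (\<F> X)" and z: "z \<in> hom P Z A"
  shows "sat (ex P p \<alpha>) z \<longleftrightarrow> (\<exists>x\<in>hom P Z X. p \<cdot> x = z \<and> sat \<alpha> x)"
proof -
  have p: "is_projection P p" using X by (auto simp: is_projection_def)
  have pq: "p \<in> hom P X A" "q \<in> hom P X B" using X by (auto simp: is_product_def)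
  have obj: "Z \<in> Obj P" "B \<in> Obj P" "X \<in> Obj P" using z pq hom_obj by auto
  have ex: "ex P p \<alpha> \<in> carrier (\<F> A)" "\<alpha> \<sqsubseteq>\<^bsub>\<F> X\<^esub> reindex P p (ex P p \<alpha>)"
    using ex_closed[OF p] ex_unit[OF p] \<alpha> pq by (auto simp: hom_def)
  show ?thesis
  proof
    assume "\<exists>x\<in>hom P Z X. p \<cdot> x = z \<and> sat \<alpha> x"
    then obtain x where x: "x \<in> hom P Z X" "p \<cdot> x = z" "sat \<alpha> x" by blast
    \<comment> \<open>The unit of the adjunction, evaluated at the witness \<open>x\<close>.\<close>
    have "sat (reindex P p (ex P p \<alpha>)) x"
      using sat_mono[of x X \<alpha>] x \<alpha> ex pq by (auto simp: hom_def)
    then show "sat (ex P p \<alpha>) z" using x ex pq by (auto simp: hom_def)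
  next
    assume sat: "sat (ex P p \<alpha>) z"
    have f: "z \<cdot> pr1 P Z B \<in> hom P (Z \<otimes> B) A" "pr2 P Z B \<in> hom P (Z \<otimes> B) B" "Z \<otimes> B \<in> Obj P"
      using z obj by (auto simp: hom_def)
    then obtain h where h: "h \<in> hom P (Z \<otimes> B) X" "p \<cdot> h = z \<cdot> pr1 P Z B" "q \<cdot> h = pr2 P Z B"
      using X unfolding is_product_def by meson
    have "ex P (pr1 P Z B) (reindex P h \<alpha>) = reindex P z (ex P p \<alpha>)"
      using existential p pullback_product[OF X z h] \<alpha> pq
      unfolding is_existential_def by (auto simp: hom_def)
    also have "\<dots> = \<top>\<^bsub>\<F> Z\<^esub>" using sat z by (auto simp: sat_def hom_def)
    finally have "\<top>\<^bsub>\<F> Z\<^esub> \<sqsubseteq>\<^bsub>\<F> Z\<^esub> ex P (pr1 P Z B) (reindex P h \<alpha>)"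
      using obj by (simp add: top_le_iff)
    moreover have h\<alpha>: "reindex P h \<alpha> \<in> carrier (\<F> (Z \<otimes> B))" using h \<alpha> by (auto simp: hom_def)
    ultimately obtain w where w: "w \<in> hom P Z B"
      "\<top>\<^bsub>\<F> Z\<^esub> \<sqsubseteq>\<^bsub>\<F> Z\<^esub> reindex P (pair P (Ident P Z) w) (reindex P h \<alpha>)"
      using choice[OF obj(1,2)] by blast
    \<comment> \<open>The choice \<open>w\<close> gives a section of the projection
      \<open>pr1 P Z B\<close>; its image under \<open>h\<close> is the required element of
      \<open>X\<close> over \<open>z\<close>.\<close>
    let ?k = "pair P (Ident P Z) w"
    have k: "?k \<in> hom P Z (Z \<otimes> B)" using w obj by (auto simp: hom_def)
    have "sat (reindex P h \<alpha>) ?k"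
      using w h\<alpha> k obj by (auto simp: sat_def top_le_iff hom_def)
    then have "sat \<alpha> (h \<cdot> ?k)" using h k \<alpha> by (auto simp: hom_def)
    moreover have "p \<cdot> (h \<cdot> ?k) = (p \<cdot> h) \<cdot> ?k" using pq h(1) k by (simp add: hom_def)
    then have "p \<cdot> (h \<cdot> ?k) = z"
      unfolding h(2) using z w obj by (simp add: hom_def)
    moreover have "h \<cdot> ?k \<in> hom P Z X" using k h(1) by (rule comp_hom)
    ultimately show "\<exists>x\<in>hom P Z X. p \<cdot> x = z \<and> sat \<alpha> x" by blast
  qed
qed

lemma t13_projection: "\<lbrakk>A \<in> Obj P; B \<in> Obj P; C \<in> Obj P\<rbrakk> \<Longrightarrow> is_projection P (t13 P A B C)"
  using t13_product unfolding is_projection_def by blast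

text \<open>An element of the triple product lying over \<open>pair P a c\<close> is determined by
  its middle component, which is thus the quantified variable.\<close>

lemma rel_ex_t13_iff:
  assumes "A \<in> Obj P" "B \<in> Obj P" "C \<in> Obj P" "\<alpha> \<in> carrier (\<F> (A \<otimes> B \<otimes> C))"
    and ac: "a \<in> hom P Z A" "c \<in> hom P Z C"
  shows "rel (ex P (t13 P A B C) \<alpha>) a c \<longleftrightarrow> (\<exists>b\<in>hom P Z B. rel \<alpha> (pair P a b) c)"
proof -
  have z: "pair P a c \<in> hom P Z (A \<otimes> C)" using ac by (auto simp: hom_def)
  have "(\<exists>x\<in>hom P Z (A \<otimes> B \<otimes> C). t13 P A B C \<cdot> x = pair P a c \<and> sat \<alpha> x) \<longleftrightarrow>
      (\<exists>b\<in>hom P Z B. rel \<alpha> (pair P a b) c)"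
  proof
    assume "\<exists>x\<in>hom P Z (A \<otimes> B \<otimes> C). t13 P A B C \<cdot> x = pair P a c \<and> sat \<alpha> x"
    then obtain x where x: "x \<in> hom P Z (A \<otimes> B \<otimes> C)" "t13 P A B C \<cdot> x = pair P a c" "sat \<alpha> x"
      by blast
    obtain y c' where y: "y \<in> hom P Z (A \<otimes> B)" "c' \<in> hom P Z C" "x = pair P y c'"
      using elem_pairE[OF x(1)] assms by auto
    obtain a' b where ab: "a' \<in> hom P Z A" "b \<in> hom P Z B" "y = pair P a' b"
      using elem_pairE[OF y(1)] assms by auto
    have "pair P a' c' = pair P a c" using x y ab by (auto simp: hom_def)
    then have "a' = a" "c' = c" using pair_eq_iff[OF ab(1) y(2) ac] by auto
    with x y ab show "\<exists>b\<in>hom P Z B. rel \<alpha> (pair P a b) c" by blast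
  next
    assume "\<exists>b\<in>hom P Z B. rel \<alpha> (pair P a b) c"
    then obtain b where b: "b \<in> hom P Z B" "rel \<alpha> (pair P a b) c" by blast
    with ac have "pair P (pair P a b) c \<in> hom P Z (A \<otimes> B \<otimes> C)"
      "t13 P A B C \<cdot> pair P (pair P a b) c = pair P a c" by (auto simp: hom_def)
    with b show "\<exists>x\<in>hom P Z (A \<otimes> B \<otimes> C). t13 P A B C \<cdot> x = pair P a c \<and> sat \<alpha> x" by blast
  qed
  with sat_ex_iff[OF t13_product[OF assms(1-3)] assms(4) z] show ?thesis by simp
qed

text \<open>The top holds at every element, so the inequality says that the existential statement
  holds at every stage.\<close>

lemma top_le_ex_iff:
  assumes "A \<in> Obj P" "B \<in> Obj P" "\<alpha> \<in> carrier (\<F> (A \<otimes> B))"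
  shows "\<top>\<^bsub>\<F> A\<^esub> \<sqsubseteq>\<^bsub>\<F> A\<^esub> ex P (pr1 P A B) \<alpha> \<longleftrightarrow> (\<forall>Z. \<forall>a\<in>hom P Z A. \<exists>b\<in>hom P Z B. rel \<alpha> a b)"
proof -
  have p: "is_projection P (pr1 P A B)"
    using product[OF assms(1,2)] by (auto simp: is_projection_def)
  have ex: "ex P (pr1 P A B) \<alpha> \<in> carrier (\<F> A)" using ex_closed[OF p] assms by simp
  have "sat (ex P (pr1 P A B) \<alpha>) a \<longleftrightarrow> (\<exists>b\<in>hom P Z B. rel \<alpha> a b)" if a: "a \<in> hom P Z A" for Z a
  proof -
    have "(\<exists>x\<in>hom P Z (A \<otimes> B). pr1 P A B \<cdot> x = a \<and> sat \<alpha> x) \<longleftrightarrow> (\<exists>b\<in>hom P Z B. rel \<alpha> a b)"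
    proof
      assume "\<exists>x\<in>hom P Z (A \<otimes> B). pr1 P A B \<cdot> x = a \<and> sat \<alpha> x"
      then obtain x where x: "x \<in> hom P Z (A \<otimes> B)" "pr1 P A B \<cdot> x = a" "sat \<alpha> x" by blast
      then have "rel \<alpha> a (pr2 P A B \<cdot> x)" using pair_unique[OF x(1) assms(1,2)] by simp
      moreover have "pr2 P A B \<cdot> x \<in> hom P Z B" using x assms by (auto simp: hom_def)
      ultimately show "\<exists>b\<in>hom P Z B. rel \<alpha> a b" by blast
    next
      assume "\<exists>b\<in>hom P Z B. rel \<alpha> a b"
      then obtain b where b: "b \<in> hom P Z B" "rel \<alpha> a b" by blast
      with a have "pair P a b \<in> hom P Z (A \<otimes> B)" "pr1 P A B \<cdot> pair P a b = a"
        by (auto simp: hom_def)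
      with b show "\<exists>x\<in>hom P Z (A \<otimes> B). pr1 P A B \<cdot> x = a \<and> sat \<alpha> x" by blast
    qed
    with sat_ex_iff[OF product[OF assms(1,2)] assms(3) a] show ?thesis by simp
  qed
  moreover have "\<top>\<^bsub>\<F> A\<^esub> \<sqsubseteq>\<^bsub>\<F> A\<^esub> ex P (pr1 P A B) \<alpha> \<longleftrightarrow>
      (\<forall>Z. \<forall>a\<in>hom P Z A. sat (ex P (pr1 P A B) \<alpha>) a)"
    using le_iff_sat[OF assms(1) _ ex, of "\<top>\<^bsub>\<F> A\<^esub>"] assms(1) by (auto simp: hom_def)
  ultimately show ?thesis by auto
qed

text \<open>The first adjunction of \<open>is_equality\<close>, evaluated at the top: there the left
  adjoint takes the value \<delta>. It serves both for the uniqueness of \<delta> and for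
  reflexivity of equivalence relations.\<close>

lemma is_equality_le_iff:
  assumes A: "A \<in> Obj P" and \<delta>: "is_equality P A \<delta>" and \<beta>: "\<beta> \<in> carrier (\<F> (A \<otimes> A))"
  shows "\<delta> \<sqsubseteq>\<^bsub>\<F> (A \<otimes> A)\<^esub> \<beta> \<longleftrightarrow> rel \<beta> (Ident P A) (Ident P A)"
proof -
  let ?d = "pair P (Ident P A) (Ident P A)"
  have \<delta>c: "\<delta> \<in> carrier (\<F> (A \<otimes> A))" using \<delta> by (simp add: is_equality_def)
  have "left_adjoint (\<F> A) (\<F> (A \<otimes> A)) (\<lambda>\<alpha>. reindex P (pr1 P A A) \<alpha> \<sqinter>\<^bsub>\<F> (A \<otimes> A)\<^esub> \<delta>) (reindex P ?d)"
    using \<delta> by (simp add: is_equality_def)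
  from galois_connection.galois_property[OF this[unfolded left_adjoint_def], of "\<top>\<^bsub>\<F> A\<^esub>" \<beta>]
  have "reindex P (pr1 P A A) \<top>\<^bsub>\<F> A\<^esub> \<sqinter>\<^bsub>\<F> (A \<otimes> A)\<^esub> \<delta> \<sqsubseteq>\<^bsub>\<F> (A \<otimes> A)\<^esub> \<beta> \<longleftrightarrow>
      \<top>\<^bsub>\<F> A\<^esub> \<sqsubseteq>\<^bsub>\<F> A\<^esub> reindex P ?d \<beta>"
    using A \<beta> by simp
  moreover have "reindex P (pr1 P A A) \<top>\<^bsub>\<F> A\<^esub> = \<top>\<^bsub>\<F> (A \<otimes> A)\<^esub>"
    using sat_top[of "pr1 P A A" A] A by (simp add: sat_def)
  ultimately show ?thesis
    using A \<beta> \<delta>c by (simp add: top_meet top_le_iff sat_def)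
qed

text \<open>\<open>delta\<close> is a definite description, so uniqueness is required: by
  \<open>is_equality_le_iff\<close>, two candidates lie below the same elements, hence below each
  other.\<close>

lemma delta_equality:
  assumes A: "A \<in> Obj P"
  shows "is_equality P A (delta P A)"
  unfolding delta_def
proof (rule theI')
  interpret partial_order "\<F> (A \<otimes> A)" using A by (simp add: partial_order_fibre)
  obtain \<delta> where \<delta>: "is_equality P A \<delta>"
    using elementary A by (auto simp: is_elementary_def)
  have "\<delta>' = \<delta>" if \<delta>': "is_equality P A \<delta>'" for \<delta>'
  proof -
    have c: "\<delta> \<in> carrier (\<F> (A \<otimes> A))" "\<delta>' \<in> carrier (\<F> (A \<otimes> A))"
      using \<delta> \<delta>' by (simp_all add: is_equality_def)
    then show ?thesis
      using is_equality_le_iff[OF A \<delta>] is_equality_le_iff[OF A \<delta>'] le_refl[OF c(1)] le_refl[OF c(2)]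
      by (intro le_antisym) auto
  qed
  with \<delta> show "\<exists>!\<delta>. is_equality P A \<delta>" by blast
qed

section \<open>Equivalence relations and functional relations, pointwise\<close>

lemma eq_objD:
  assumes "X \<in> eq_obj P"
  shows "fst X \<in> Obj P" "snd X \<in> carrier (\<F> (fst X \<otimes> fst X))"
  using assms by (auto simp: eq_obj_def is_equivalence_relation_def)

text \<open>Lying above \<open>delta\<close> gives reflexivity at the generic element
  \<open>Ident P (fst X)\<close>; stability under change of stage carries it to
  \<open>a\<close>.\<close>

lemma eq_obj_refl:
  assumes X: "X \<in> eq_obj P" and a: "a \<in> hom P Z (fst X)"
  shows "rel (snd X) a a"
proof -
  note [simp] = eq_objD[OF X]
  have "delta P (fst X) \<sqsubseteq>\<^bsub>\<F> (fst X \<otimes> fst X)\<^esub> snd X"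
    using X by (auto simp: eq_obj_def is_equivalence_relation_def)
  then have "rel (snd X) (Ident P (fst X)) (Ident P (fst X))"
    using is_equality_le_iff[OF _ delta_equality] by simp
  then have "sat (snd X) (pair P (Ident P (fst X)) (Ident P (fst X)) \<cdot> a)"
    using a by (intro sat_comp) (auto simp: hom_def)
  then show ?thesis using a by (simp add: hom_def)
qed

lemma eq_obj_sym:
  assumes X: "X \<in> eq_obj P" and ab: "a \<in> hom P Z (fst X)" "b \<in> hom P Z (fst X)"
    and "rel (snd X) a b"
  shows "rel (snd X) b a"
proof -
  note [simp] = eq_objD[OF X]
  have "snd X \<sqsubseteq>\<^bsub>\<F> (fst X \<otimes> fst X)\<^esub> reindex P (pair P (pr2 P (fst X) (fst X)) (pr1 P (fst X) (fst X))) (snd X)"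
    using X by (auto simp: eq_obj_def is_equivalence_relation_def)
  then have "rel (reindex P (pair P (pr2 P (fst X) (fst X)) (pr1 P (fst X) (fst X))) (snd X)) a b"
    using assms by (subst (asm) le_iff_rel) auto
  then show ?thesis using ab by (auto simp: hom_def)
qed

lemma eq_obj_trans:
  assumes X: "X \<in> eq_obj P"
    and abc: "a \<in> hom P Z (fst X)" "b \<in> hom P Z (fst X)" "c \<in> hom P Z (fst X)"
    and "rel (snd X) a b" "rel (snd X) b c"
  shows "rel (snd X) a c"
proof -
  note [simp] = eq_objD[OF X]
  let ?A = "fst X"
  have "reindex P (t12 P ?A ?A ?A) (snd X) \<sqinter>\<^bsub>\<F> (?A \<otimes> ?A \<otimes> ?A)\<^esub> reindex P (t23 P ?A ?A ?A) (snd X)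
       \<sqsubseteq>\<^bsub>\<F> (?A \<otimes> ?A \<otimes> ?A)\<^esub> reindex P (t13 P ?A ?A ?A) (snd X)"
    using X by (auto simp: eq_obj_def is_equivalence_relation_def)
  moreover have "rel (reindex P (t12 P ?A ?A ?A) (snd X) \<sqinter>\<^bsub>\<F> (?A \<otimes> ?A \<otimes> ?A)\<^esub>
      reindex P (t23 P ?A ?A ?A) (snd X)) (pair P a b) c"
    using assms by (simp add: hom_def)
  ultimately have "rel (reindex P (t13 P ?A ?A ?A) (snd X)) (pair P a b) c"
    using abc by (subst (asm) le_iff_rel3) auto
  then show ?thesis using abc by (simp add: hom_def)
qed

text \<open>The conditions become invariance on either side, single-valuedness up to the target
  relation, and totality. The pointwise translation presupposes that \<phi> lies in the fibre;
  otherwise both sides are false.\<close>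

lemma functional_relation_iff:
  assumes X: "X \<in> eq_obj P" and Y: "Y \<in> eq_obj P"
  shows "is_functional_relation P X Y \<phi> \<longleftrightarrow>
    \<phi> \<in> carrier (\<F> (fst X \<otimes> fst Y)) \<and>
    (\<forall>Z. \<forall>a\<in>hom P Z (fst X). \<forall>a'\<in>hom P Z (fst X). \<forall>b\<in>hom P Z (fst Y).
       rel (snd X) a a' \<and> rel \<phi> a' b \<longrightarrow> rel \<phi> a b) \<and>
    (\<forall>Z. \<forall>a\<in>hom P Z (fst X). \<forall>b\<in>hom P Z (fst Y). \<forall>b'\<in>hom P Z (fst Y).
       rel \<phi> a b \<and> rel (snd Y) b b' \<longrightarrow> rel \<phi> a b') \<and>
    (\<forall>Z. \<forall>a\<in>hom P Z (fst X). \<forall>b\<in>hom P Z (fst Y). \<forall>b'\<in>hom P Z (fst Y).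
       rel \<phi> a b \<and> rel \<phi> a b' \<longrightarrow> rel (snd Y) b b') \<and>
    (\<forall>Z. \<forall>a\<in>hom P Z (fst X). \<exists>b\<in>hom P Z (fst Y). rel \<phi> a b)"
proof (cases "\<phi> \<in> carrier (\<F> (fst X \<otimes> fst Y))")
  case True
  note [simp] = eq_objD[OF X] eq_objD[OF Y] True
  show ?thesis
    unfolding is_functional_relation_def Let_def
    by (simp add: le_iff_rel3 top_le_ex_iff) (simp add: hom_def)
qed (simp add: is_functional_relation_def Let_def)

lemma rel_comp_closed:
  assumes "A \<in> Obj P" "B \<in> Obj P" "C \<in> Obj P"
    "\<phi> \<in> carrier (\<F> (A \<otimes> B))" "\<psi> \<in> carrier (\<F> (B \<otimes> C))"
  shows "rel_comp P A B C \<psi> \<phi> \<in> carrier (\<F> (A \<otimes> C))"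
  unfolding rel_comp_def using assms ex_closed[OF t13_projection[OF assms(1-3)]] by simp

lemma rel_rel_comp_iff:
  assumes "A \<in> Obj P" "B \<in> Obj P" "C \<in> Obj P"
    "\<phi> \<in> carrier (\<F> (A \<otimes> B))" "\<psi> \<in> carrier (\<F> (B \<otimes> C))"
    "a \<in> hom P Z A" "c \<in> hom P Z C"
  shows "rel (rel_comp P A B C \<psi> \<phi>) a c \<longleftrightarrow> (\<exists>b\<in>hom P Z B. rel \<phi> a b \<and> rel \<psi> b c)"
  unfolding rel_comp_def using assms by (subst rel_ex_t13_iff) (auto simp: hom_def)

lemma q_reps_iff:
  assumes X: "X \<in> eq_obj P" and Y: "Y \<in> eq_obj P"
  shows "f \<in> q_reps P X Y \<longleftrightarrow> f \<in> hom P (fst X) (fst Y) \<and>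
    (\<forall>Z. \<forall>a\<in>hom P Z (fst X). \<forall>a'\<in>hom P Z (fst X). rel (snd X) a a' \<longrightarrow> rel (snd Y) (f \<cdot> a) (f \<cdot> a'))"
proof (cases "f \<in> hom P (fst X) (fst Y)")
  case True
  note [simp] = eq_objD[OF X] eq_objD[OF Y]
  have "f \<in> Arr P" "Dom P f = fst X" "Cod P f = fst Y" using True by (auto simp: hom_def)
  then show ?thesis using True by (simp add: q_reps_def le_iff_rel) (simp add: hom_def)
qed (simp add: q_reps_def)

lemma q_rel_iff:
  assumes X: "X \<in> eq_obj P" and Y: "Y \<in> eq_obj P"
  shows "(f, g) \<in> q_rel P X Y \<longleftrightarrow> f \<in> q_reps P X Y \<and> g \<in> q_reps P X Y \<and>
    (\<forall>Z. \<forall>a\<in>hom P Z (fst X). \<forall>a'\<in>hom P Z (fst X). rel (snd X) a a' \<longrightarrow> rel (snd Y) (f \<cdot> a) (g \<cdot> a'))"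
proof (cases "f \<in> q_reps P X Y \<and> g \<in> q_reps P X Y")
  case True
  note [simp] = eq_objD[OF X] eq_objD[OF Y]
  have "f \<in> Arr P" "Dom P f = fst X" "Cod P f = fst Y" "g \<in> Arr P" "Dom P g = fst X" "Cod P g = fst Y"
    using True by (auto simp: q_reps_def hom_def)
  then show ?thesis using True by (simp add: q_rel_def le_iff_rel) (simp add: hom_def)
qed (auto simp: q_rel_def)

lemma graph_closed:
  assumes X: "X \<in> eq_obj P" and Y: "Y \<in> eq_obj P" and f: "f \<in> hom P (fst X) (fst Y)"
  shows "graph P X Y f \<in> carrier (\<F> (fst X \<otimes> fst Y))"
proof -
  note [simp] = eq_objD[OF X] eq_objD[OF Y]
  have "f \<in> Arr P" "Dom P f = fst X" "Cod P f = fst Y" using f by (auto simp: hom_def)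
  then show ?thesis
    unfolding graph_def Let_def using ex_closed[OF t13_projection[of "fst X" "fst X" "fst Y"]] by simp
qed

text \<open>The formula for \<open>graph\<close> asks for some \<open>a'\<close> related to
  \<open>a\<close> with \<open>f \<cdot> a'\<close> related to \<open>b\<close>. Compatibility of
  \<open>f\<close> and transitivity eliminate \<open>a'\<close>; conversely \<open>a' = a\<close> is
  a witness.\<close>

lemma rel_graph_iff:
  assumes X: "X \<in> eq_obj P" and Y: "Y \<in> eq_obj P" and f: "f \<in> q_reps P X Y"
    and a: "a \<in> hom P Z (fst X)" and b: "b \<in> hom P Z (fst Y)"
  shows "rel (graph P X Y f) a b \<longleftrightarrow> rel (snd Y) (f \<cdot> a) b"
proof -
  note [simp] = eq_objD[OF X] eq_objD[OF Y]
  have fh: "f \<in> hom P (fst X) (fst Y)" using f by (simp add: q_reps_def)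
  then have fa: "f \<cdot> a' \<in> hom P Z (fst Y)" if "a' \<in> hom P Z (fst X)" for a'
    using that comp_hom by blast
  have "rel (graph P X Y f) a b \<longleftrightarrow> (\<exists>a'\<in>hom P Z (fst X). rel (snd X) a a' \<and> rel (snd Y) (f \<cdot> a') b)"
    unfolding graph_def Let_def
    using a b fh by (subst rel_ex_t13_iff) (auto simp: hom_def)
  also have "\<dots> \<longleftrightarrow> rel (snd Y) (f \<cdot> a) b"
  proof
    assume "\<exists>a'\<in>hom P Z (fst X). rel (snd X) a a' \<and> rel (snd Y) (f \<cdot> a') b"
    then obtain a' where a': "a' \<in> hom P Z (fst X)" "rel (snd X) a a'" "rel (snd Y) (f \<cdot> a') b"
      by blast
    then have "rel (snd Y) (f \<cdot> a) (f \<cdot> a')" using f a unfolding q_reps_iff[OF X Y] by blast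
    with a' show "rel (snd Y) (f \<cdot> a) b" using eq_obj_trans[OF Y fa[OF a] fa[OF a'(1)] b] by blast
  qed (use a eq_obj_refl[OF X] in blast)
  finally show ?thesis .
qed

lemma functional_relationD:
  assumes X: "X \<in> eq_obj P" and Y: "Y \<in> eq_obj P" and \<phi>: "is_functional_relation P X Y \<phi>"
  shows "\<phi> \<in> carrier (\<F> (fst X \<otimes> fst Y))"
    and "\<lbrakk>a \<in> hom P Z (fst X); a' \<in> hom P Z (fst X); b \<in> hom P Z (fst Y);
      rel (snd X) a a'; rel \<phi> a' b\<rbrakk> \<Longrightarrow> rel \<phi> a b"
    and "\<lbrakk>a \<in> hom P Z (fst X); b \<in> hom P Z (fst Y); b' \<in> hom P Z (fst Y);
      rel \<phi> a b; rel (snd Y) b b'\<rbrakk> \<Longrightarrow> rel \<phi> a b'"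
    and "\<lbrakk>a \<in> hom P Z (fst X); b \<in> hom P Z (fst Y); b' \<in> hom P Z (fst Y);
      rel \<phi> a b; rel \<phi> a b'\<rbrakk> \<Longrightarrow> rel (snd Y) b b'"
    and "a \<in> hom P Z (fst X) \<Longrightarrow> \<exists>b\<in>hom P Z (fst Y). rel \<phi> a b"
  using \<phi> unfolding functional_relation_iff[OF X Y] by blast+

lemma functional_relation_comp:
  assumes X: "X \<in> eq_obj P" and Y: "Y \<in> eq_obj P" and Z: "Z \<in> eq_obj P"
    and \<phi>: "is_functional_relation P X Y \<phi>" and \<psi>: "is_functional_relation P Y Z \<psi>"
  shows "is_functional_relation P X Z (rel_comp P (fst X) (fst Y) (fst Z) \<psi> \<phi>)"
proof -
  note f = functional_relationD[OF X Y \<phi>] and g = functional_relationD[OF Y Z \<psi>]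
  note obj = eq_objD(1)[OF X] eq_objD(1)[OF Y] eq_objD(1)[OF Z]
  note iff = rel_rel_comp_iff[OF obj f(1) g(1)]
  show ?thesis
    unfolding functional_relation_iff[OF X Z]
  proof (intro conjI allI ballI impI)
    show "rel_comp P (fst X) (fst Y) (fst Z) \<psi> \<phi> \<in> carrier (\<F> (fst X \<otimes> fst Z))"
      using rel_comp_closed[OF obj f(1) g(1)] .
  next
    fix W a a' c
    assume "a \<in> hom P W (fst X)" "a' \<in> hom P W (fst X)" "c \<in> hom P W (fst Z)"
      "rel (snd X) a a' \<and> rel (rel_comp P (fst X) (fst Y) (fst Z) \<psi> \<phi>) a' c"
    then show "rel (rel_comp P (fst X) (fst Y) (fst Z) \<psi> \<phi>) a c"
      using f(2)[of a W a'] by (auto simp: iff)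
  next
    fix W a c c'
    assume "a \<in> hom P W (fst X)" "c \<in> hom P W (fst Z)" "c' \<in> hom P W (fst Z)"
      "rel (rel_comp P (fst X) (fst Y) (fst Z) \<psi> \<phi>) a c \<and> rel (snd Z) c c'"
    then show "rel (rel_comp P (fst X) (fst Y) (fst Z) \<psi> \<phi>) a c'"
      using g(3)[of _ W c c'] by (auto simp: iff)
  next
    fix W a c c'
    assume a: "a \<in> hom P W (fst X)" and c: "c \<in> hom P W (fst Z)" "c' \<in> hom P W (fst Z)"
      and r: "rel (rel_comp P (fst X) (fst Y) (fst Z) \<psi> \<phi>) a c \<and>
        rel (rel_comp P (fst X) (fst Y) (fst Z) \<psi> \<phi>) a c'"
    then obtain b b' where b: "b \<in> hom P W (fst Y)" "b' \<in> hom P W (fst Y)"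
      "rel \<phi> a b" "rel \<psi> b c" "rel \<phi> a b'" "rel \<psi> b' c'"
      by (auto simp: iff)
    then have "rel (snd Y) b b'" using f(4) a by blast
    \<comment> \<open>The two intermediate elements agree only up to the relation of
      \<open>Y\<close>; invariance of \<psi> moves the second pair to \<open>b\<close>, where
      single-valuedness applies.\<close>
    then have "rel \<psi> b c'" using g(2) b c by blast
    then show "rel (snd Z) c c'" using g(4) b c by blast
  next
    fix W a assume a: "a \<in> hom P W (fst X)"
    then obtain b where b: "b \<in> hom P W (fst Y)" "rel \<phi> a b" using f(5) by blast
    then obtain c where "c \<in> hom P W (fst Z)" "rel \<psi> b c" using g(5) by blast
    then show "\<exists>c\<in>hom P W (fst Z). rel (rel_comp P (fst X) (fst Y) (fst Z) \<psi> \<phi>) a c"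
      using a b iff by blast
  qed
qed

text \<open>Both invariances are transitivity, single-valuedness is symmetry with transitivity, and
  totality is reflexivity.\<close>

lemma functional_relation_ident:
  assumes X: "X \<in> eq_obj P"
  shows "is_functional_relation P X X (snd X)"
  unfolding functional_relation_iff[OF X X]
  using eq_objD(2)[OF X] eq_obj_refl[OF X] eq_obj_sym[OF X] eq_obj_trans[OF X] by blast

section \<open>The category of functional relations\<close>

lemma EP_hom_iff:
  "\<Phi> \<in> hom (EP P) X Y \<longleftrightarrow>
    X \<in> eq_obj P \<and> Y \<in> eq_obj P \<and> (\<exists>\<phi>. is_functional_relation P X Y \<phi> \<and> \<Phi> = (X, Y, \<phi>))"
  by (auto simp: hom_def EP_def)

lemma EP_homE:
  assumes "\<Phi> \<in> hom (EP P) X Y"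
  obtains \<phi> where "X \<in> eq_obj P" "Y \<in> eq_obj P" "is_functional_relation P X Y \<phi>" "\<Phi> = (X, Y, \<phi>)"
  using assms unfolding EP_hom_iff by blast

lemma EP_simps:
  "Obj (EP P) = eq_obj P"
  "Dom (EP P) (X, Y, \<phi>) = X"
  "Cod (EP P) (X, Y, \<phi>) = Y"
  "Ident (EP P) X = (X, X, snd X)"
  "(Y', Z, \<psi>) \<cdot>\<^bsub>EP P\<^esub> (X, Y, \<phi>) = (X, Z, rel_comp P (fst X) (fst Y) (fst Z) \<psi> \<phi>)"
  by (simp_all add: EP_def)

lemma category_EP: "category (EP P)"
proof
  show "Dom (EP P) \<Phi> \<in> Obj (EP P)" "Cod (EP P) \<Phi> \<in> Obj (EP P)" if "\<Phi> \<in> Arr (EP P)" for \<Phi>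
    using that by (auto simp: EP_def)
  show "Ident (EP P) X \<in> hom (EP P) X X" if "X \<in> Obj (EP P)" for X
    using that functional_relation_ident by (simp add: EP_simps EP_hom_iff)
  show "\<Psi> \<cdot>\<^bsub>EP P\<^esub> \<Phi> \<in> hom (EP P) X Z" if "\<Phi> \<in> hom (EP P) X Y" "\<Psi> \<in> hom (EP P) Y Z" for \<Phi> \<Psi> X Y Z
    using that by (auto simp: EP_simps EP_hom_iff intro!: functional_relation_comp)
  show "\<Phi> \<cdot>\<^bsub>EP P\<^esub> Ident (EP P) X = \<Phi>" if hom: "\<Phi> \<in> hom (EP P) X Y" for \<Phi> X Y
    using hom
  proof (rule EP_homE)
    fix \<phi> assume X: "X \<in> eq_obj P" and Y: "Y \<in> eq_obj P"
      and \<phi>: "is_functional_relation P X Y \<phi>" "\<Phi> = (X, Y, \<phi>)"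
    note obj = eq_objD[OF X] eq_objD(1)[OF Y] and f = functional_relationD[OF X Y \<phi>(1)]
    \<comment> \<open>Invariance of \<phi> gives one inclusion; the intermediate element
      \<open>a\<close> itself, by reflexivity, gives the other.\<close>
    have "rel_comp P (fst X) (fst X) (fst Y) \<phi> (snd X) = \<phi>"
    proof (rule eq_rel[OF obj(1,3) rel_comp_closed[OF obj(1,1,3,2) f(1)] f(1)])
      fix Z a b assume "a \<in> hom P Z (fst X)" "b \<in> hom P Z (fst Y)"
      then show "rel (rel_comp P (fst X) (fst X) (fst Y) \<phi> (snd X)) a b \<longleftrightarrow> rel \<phi> a b"
        using rel_rel_comp_iff[OF obj(1,1,3,2) f(1)] f(2) eq_obj_refl[OF X] by blast
    qed
    then show ?thesis by (simp add: EP_simps \<phi>)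
  qed
  show "Ident (EP P) Y \<cdot>\<^bsub>EP P\<^esub> \<Phi> = \<Phi>" if hom: "\<Phi> \<in> hom (EP P) X Y" for \<Phi> X Y
    using hom
  proof (rule EP_homE)
    fix \<phi> assume X: "X \<in> eq_obj P" and Y: "Y \<in> eq_obj P"
      and \<phi>: "is_functional_relation P X Y \<phi>" "\<Phi> = (X, Y, \<phi>)"
    note obj = eq_objD(1)[OF X] eq_objD[OF Y] and f = functional_relationD[OF X Y \<phi>(1)]
    have "rel_comp P (fst X) (fst Y) (fst Y) (snd Y) \<phi> = \<phi>"
    proof (rule eq_rel[OF obj(1,2) rel_comp_closed[OF obj(1,2,2) f(1) obj(3)] f(1)])
      fix Z a b assume "a \<in> hom P Z (fst X)" "b \<in> hom P Z (fst Y)"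
      then show "rel (rel_comp P (fst X) (fst Y) (fst Y) (snd Y) \<phi>) a b \<longleftrightarrow> rel \<phi> a b"
        using rel_rel_comp_iff[OF obj(1,2,2) f(1) obj(3)] f(3) eq_obj_refl[OF Y] by blast
    qed
    then show ?thesis by (simp add: EP_simps \<phi>)
  qed
  show "\<Theta> \<cdot>\<^bsub>EP P\<^esub> (\<Psi> \<cdot>\<^bsub>EP P\<^esub> \<Phi>) = (\<Theta> \<cdot>\<^bsub>EP P\<^esub> \<Psi>) \<cdot>\<^bsub>EP P\<^esub> \<Phi>"
    if \<Phi>: "\<Phi> \<in> hom (EP P) X Y" and \<Psi>: "\<Psi> \<in> hom (EP P) Y Z" and \<Theta>: "\<Theta> \<in> hom (EP P) Z W"
    for \<Phi> \<Psi> \<Theta> X Y Z W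
  proof -
    obtain \<phi> \<psi> \<theta> where X: "X \<in> eq_obj P" and Y: "Y \<in> eq_obj P" and Z: "Z \<in> eq_obj P"
      and W: "W \<in> eq_obj P" and \<phi>: "is_functional_relation P X Y \<phi>" "\<Phi> = (X, Y, \<phi>)"
      and \<psi>: "is_functional_relation P Y Z \<psi>" "\<Psi> = (Y, Z, \<psi>)"
      and \<theta>: "is_functional_relation P Z W \<theta>" "\<Theta> = (Z, W, \<theta>)"
      using \<Phi> \<Psi> \<Theta> unfolding EP_hom_iff by blast
    note obj = eq_objD(1)[OF X] eq_objD(1)[OF Y] eq_objD(1)[OF Z] eq_objD(1)[OF W]
    note closed = functional_relationD(1)[OF X Y \<phi>(1)] functional_relationD(1)[OF Y Z \<psi>(1)]
      functional_relationD(1)[OF Z W \<theta>(1)]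
    note c1 = rel_comp_closed[OF obj(1,2,3) closed(1,2)] and c2 = rel_comp_closed[OF obj(2,3,4) closed(2,3)]
    let ?c = "rel_comp P"
    \<comment> \<open>Both sides ask for the same two intermediate elements at the stage
      \<open>V\<close>, so only the order of the quantifiers differs.\<close>
    have "?c (fst X) (fst Z) (fst W) \<theta> (?c (fst X) (fst Y) (fst Z) \<psi> \<phi>) =
        ?c (fst X) (fst Y) (fst W) (?c (fst Y) (fst Z) (fst W) \<theta> \<psi>) \<phi>"
    proof (rule eq_rel[OF obj(1,4) rel_comp_closed[OF obj(1,3,4) c1 closed(3)]
          rel_comp_closed[OF obj(1,2,4) closed(1) c2]])
      fix V a d assume a: "a \<in> hom P V (fst X)" and d: "d \<in> hom P V (fst W)"
      show "rel (?c (fst X) (fst Z) (fst W) \<theta> (?c (fst X) (fst Y) (fst Z) \<psi> \<phi>)) a d \<longleftrightarrow>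
          rel (?c (fst X) (fst Y) (fst W) (?c (fst Y) (fst Z) (fst W) \<theta> \<psi>) \<phi>) a d"
        unfolding rel_rel_comp_iff[OF obj(1,3,4) c1 closed(3) a d]
          rel_rel_comp_iff[OF obj(1,2,4) closed(1) c2 a d]
        using rel_rel_comp_iff[OF obj(1,2,3) closed(1,2) a] rel_rel_comp_iff[OF obj(2,3,4) closed(2,3) _ d]
        by blast
    qed
    then show ?thesis by (simp add: EP_simps \<phi> \<psi> \<theta>)
  qed
qed

section \<open>The elementary quotient completion\<close>

text \<open>\<open>q_rel\<close> compares values at related, not only equal, arguments; reflexivity
  is therefore exactly the compatibility demanded by \<open>q_reps\<close>.\<close>

lemma equiv_q_rel:
  assumes X: "X \<in> eq_obj P" and Y: "Y \<in> eq_obj P"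
  shows "equiv (q_reps P X Y) (q_rel P X Y)"
proof (rule equivI)
  have ap: "f \<cdot> a \<in> hom P Z (fst Y)" if "f \<in> q_reps P X Y" "a \<in> hom P Z (fst X)" for f a Z
    using that comp_hom by (auto simp: q_reps_def)
  show "q_rel P X Y \<subseteq> q_reps P X Y \<times> q_reps P X Y" by (auto simp: q_rel_def)
  show "refl_on (q_reps P X Y) (q_rel P X Y)"
    by (auto simp: refl_on_def q_rel_iff[OF X Y] q_reps_iff[OF X Y])
  show "sym (q_rel P X Y)"
  proof (rule symI)
    fix f g assume fg: "(f, g) \<in> q_rel P X Y"
    then have reps: "f \<in> q_reps P X Y" "g \<in> q_reps P X Y" by (auto simp: q_rel_def)
    have "rel (snd Y) (g \<cdot> a) (f \<cdot> a')"
      if a: "a \<in> hom P Z (fst X)" "a' \<in> hom P Z (fst X)" "rel (snd X) a a'" for Z a a'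
    proof -
      have "rel (snd Y) (f \<cdot> a') (g \<cdot> a)"
        using fg a eq_obj_sym[OF X a] unfolding q_rel_iff[OF X Y] by blast
      then show ?thesis using eq_obj_sym[OF Y] ap reps a by blast
    qed
    with reps show "(g, f) \<in> q_rel P X Y" unfolding q_rel_iff[OF X Y] by blast
  qed
  show "trans (q_rel P X Y)"
  proof (rule transI)
    fix f g h assume fg: "(f, g) \<in> q_rel P X Y" and gh: "(g, h) \<in> q_rel P X Y"
    then have reps: "f \<in> q_reps P X Y" "g \<in> q_reps P X Y" "h \<in> q_reps P X Y"
      by (auto simp: q_rel_def)
    have "rel (snd Y) (f \<cdot> a) (h \<cdot> a')"
      if a: "a \<in> hom P Z (fst X)" "a' \<in> hom P Z (fst X)" "rel (snd X) a a'" for Z a a'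
    proof -
      \<comment> \<open>The passage from \<open>a\<close> to \<open>a'\<close> is spent on
        \<open>f\<close> and \<open>g\<close>; the second comparison uses reflexivity at
        \<open>a'\<close>.\<close>
      have "rel (snd Y) (f \<cdot> a) (g \<cdot> a')" "rel (snd Y) (g \<cdot> a') (h \<cdot> a')"
        using fg gh a eq_obj_refl[OF X] unfolding q_rel_iff[OF X Y] by blast+
      then show ?thesis using eq_obj_trans[OF Y] ap reps a by blast
    qed
    with reps show "(f, h) \<in> q_rel P X Y" unfolding q_rel_iff[OF X Y] by blast
  qed
qed

lemma q_rel_comp:
  assumes X: "X \<in> eq_obj P" and Y: "Y \<in> eq_obj P" and Z: "Z \<in> eq_obj P"
    and f: "(f, f') \<in> q_rel P X Y" and g: "(g, g') \<in> q_rel P Y Z"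
  shows "(g \<cdot> f, g' \<cdot> f') \<in> q_rel P X Z"
proof -
  have *: "h \<in> hom P (fst X) (fst Y) \<and> k \<in> hom P (fst Y) (fst Z) \<Longrightarrow> k \<cdot> h \<in> hom P (fst X) (fst Z)"
    "h \<in> hom P (fst X) (fst Y) \<and> a \<in> hom P W (fst X) \<Longrightarrow> h \<cdot> a \<in> hom P W (fst Y)"
    "\<lbrakk>h \<in> hom P (fst X) (fst Y); k \<in> hom P (fst Y) (fst Z); a \<in> hom P W (fst X)\<rbrakk>
       \<Longrightarrow> (k \<cdot> h) \<cdot> a = k \<cdot> (h \<cdot> a)" for h k a W
    using comp_hom comp_assoc by (blast, blast, metis)
  have comp: "rel (snd Z) ((k \<cdot> h) \<cdot> a) ((k' \<cdot> h') \<cdot> a')"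
    if hk: "(h, h') \<in> q_rel P X Y" "(k, k') \<in> q_rel P Y Z"
      and a: "a \<in> hom P W (fst X)" "a' \<in> hom P W (fst X)" "rel (snd X) a a'" for h h' k k' a a' W
  proof -
    have homs: "h \<in> hom P (fst X) (fst Y)" "h' \<in> hom P (fst X) (fst Y)"
      "k \<in> hom P (fst Y) (fst Z)" "k' \<in> hom P (fst Y) (fst Z)"
      using hk by (auto simp: q_rel_def q_reps_def)
    have "rel (snd Y) (h \<cdot> a) (h' \<cdot> a')" using hk a unfolding q_rel_iff[OF X Y] by blast
    then have "rel (snd Z) (k \<cdot> (h \<cdot> a)) (k' \<cdot> (h' \<cdot> a'))"
      using hk a *(2) homs unfolding q_rel_iff[OF Y Z] by blast
    then show ?thesis using *(3) homs a by simp
  qed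
  \<comment> \<open>A representative is an arrow related to itself, so \<open>comp\<close>, stated
    for arbitrary pairs, also shows that both composites are representatives.\<close>
  have refl: "(f, f) \<in> q_rel P X Y" "(f', f') \<in> q_rel P X Y" "(g, g) \<in> q_rel P Y Z" "(g', g') \<in> q_rel P Y Z"
    using f g unfolding q_rel_def by (auto simp: q_reps_def)
  have homs: "f \<in> hom P (fst X) (fst Y)" "f' \<in> hom P (fst X) (fst Y)"
    "g \<in> hom P (fst Y) (fst Z)" "g' \<in> hom P (fst Y) (fst Z)"
    using f g by (auto simp: q_rel_def q_reps_def)
  then have "g \<cdot> f \<in> q_reps P X Z" "g' \<cdot> f' \<in> q_reps P X Z"
    unfolding q_reps_iff[OF X Z] using comp refl *(1) by blast+
  then show ?thesis unfolding q_rel_iff[OF X Z] using comp[OF f g] by blast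
qed

lemma q_reps_comp:
  assumes X: "X \<in> eq_obj P" and Y: "Y \<in> eq_obj P" and Z: "Z \<in> eq_obj P"
    and f: "f \<in> q_reps P X Y" and g: "g \<in> q_reps P Y Z"
  shows "g \<cdot> f \<in> q_reps P X Z"
proof -
  have "(f, f) \<in> q_rel P X Y" "(g, g) \<in> q_rel P Y Z" using f g by (auto simp: q_rel_def q_reps_def)
  from q_rel_comp[OF X Y Z this] show ?thesis by (simp add: q_rel_def)
qed

lemma q_reps_ident: "X \<in> eq_obj P \<Longrightarrow> Ident P (fst X) \<in> q_reps P X X"
  using ident_hom eq_objD(1) by (auto simp: q_reps_iff ident_left)

abbreviation cls :: "'o \<times> 'p \<Rightarrow> 'o \<times> 'p \<Rightarrow> 'a \<Rightarrow> ('o \<times> 'p) \<times> ('o \<times> 'p) \<times> 'a set" where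
  "cls X Y f \<equiv> (X, Y, q_rel P X Y `` {f})"

lemma QP_simps:
  "Obj (QP P) = eq_obj P"
  "Dom (QP P) (X, Y, F) = X"
  "Cod (QP P) (X, Y, F) = Y"
  "Ident (QP P) X = cls X X (Ident P (fst X))"
  by (simp_all add: QP_def)

lemma QP_hom_iff:
  "F \<in> hom (QP P) X Y \<longleftrightarrow>
    X \<in> eq_obj P \<and> Y \<in> eq_obj P \<and> (\<exists>f\<in>q_reps P X Y. F = cls X Y f)"
  by (auto simp: hom_def QP_def quotient_def)

text \<open>\<open>Comp\<close> takes a union over all representatives; since \<open>q_rel\<close>
  is a congruence, every member of that union is the same class.\<close>

lemma QP_comp:
  assumes X: "X \<in> eq_obj P" and Y: "Y \<in> eq_obj P" and Z: "Z \<in> eq_obj P"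
    and f: "f \<in> q_reps P X Y" and g: "g \<in> q_reps P Y Z"
  shows "cls Y Z g \<cdot>\<^bsub>QP P\<^esub> cls X Y f = cls X Z (g \<cdot> f)"
proof -
  have "q_rel P X Z `` {g' \<cdot> f'} = q_rel P X Z `` {g \<cdot> f}"
    if "g' \<in> q_rel P Y Z `` {g}" "f' \<in> q_rel P X Y `` {f}" for f' g'
    using equiv_class_eq[OF equiv_q_rel[OF X Z] q_rel_comp[OF X Y Z, of f f' g g']] that by simp
  \<comment> \<open>Both classes are inhabited, so the union is not empty.\<close>
  moreover have "g \<in> q_rel P Y Z `` {g}" "f \<in> q_rel P X Y `` {f}"
    using f g by (simp_all add: q_rel_def q_reps_def)
  ultimately have "(\<Union>g\<in>q_rel P Y Z `` {g}. \<Union>f\<in>q_rel P X Y `` {f}. q_rel P X Z `` {g \<cdot> f}) =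
      q_rel P X Z `` {g \<cdot> f}" by blast
  then show ?thesis by (simp add: QP_def)
qed

lemma category_QP: "category (QP P)"
proof
  show "Dom (QP P) F \<in> Obj (QP P)" "Cod (QP P) F \<in> Obj (QP P)" if "F \<in> Arr (QP P)" for F
    using that by (auto simp: QP_def)
  show "Ident (QP P) X \<in> hom (QP P) X X" if "X \<in> Obj (QP P)" for X
    using that q_reps_ident[of X] by (auto simp: QP_simps QP_hom_iff)
  show "G \<cdot>\<^bsub>QP P\<^esub> F \<in> hom (QP P) X Z" if "F \<in> hom (QP P) X Y" "G \<in> hom (QP P) Y Z" for F G X Y Z
    using that QP_comp[of X Y Z] q_reps_comp[of X Y Z] unfolding QP_hom_iff by metis
  have hom: "f \<in> hom P (fst X) (fst Y)" if "f \<in> q_reps P X Y" for f X Y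
    using that by (simp add: q_reps_def)
  show "F \<cdot>\<^bsub>QP P\<^esub> Ident (QP P) X = F" if "F \<in> hom (QP P) X Y" for F X Y
    using that q_reps_ident[of X] by (auto simp: QP_simps QP_comp QP_hom_iff ident_right[OF hom])
  show "Ident (QP P) Y \<cdot>\<^bsub>QP P\<^esub> F = F" if "F \<in> hom (QP P) X Y" for F X Y
    using that q_reps_ident[of Y] by (auto simp: QP_simps QP_comp QP_hom_iff ident_left[OF hom])
  show "H \<cdot>\<^bsub>QP P\<^esub> (G \<cdot>\<^bsub>QP P\<^esub> F) = (H \<cdot>\<^bsub>QP P\<^esub> G) \<cdot>\<^bsub>QP P\<^esub> F"
    if "F \<in> hom (QP P) X Y" "G \<in> hom (QP P) Y Z" "H \<in> hom (QP P) Z W" for F G H X Y Z W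
    using that q_reps_comp[of X Y Z] q_reps_comp[of Y Z W]
    by (auto simp: QP_comp QP_hom_iff comp_assoc[OF hom hom hom])
qed

section \<open>The functor \<open>L\<close>\<close>

text \<open>One direction makes \<open>L\<close> well defined on classes, the other makes it
  faithful.\<close>

lemma graph_eq_iff:
  assumes X: "X \<in> eq_obj P" and Y: "Y \<in> eq_obj P"
    and f: "f \<in> q_reps P X Y" and g: "g \<in> q_reps P X Y"
  shows "graph P X Y f = graph P X Y g \<longleftrightarrow> (f, g) \<in> q_rel P X Y"
proof
  have ap: "h \<cdot> a \<in> hom P Z (fst Y)" if "h \<in> q_reps P X Y" "a \<in> hom P Z (fst X)" for h a Z
    using that comp_hom by (auto simp: q_reps_def)
  {
    assume eq: "graph P X Y f = graph P X Y g"
    have "rel (snd Y) (f \<cdot> a) (g \<cdot> a')"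
      if a: "a \<in> hom P Z (fst X)" "a' \<in> hom P Z (fst X)" "rel (snd X) a a'" for Z a a'
    proof -
      \<comment> \<open>The point of the graph of \<open>g\<close> over \<open>a'\<close> also lies
        on the graph of \<open>f\<close>, which compares the two arrows at
        \<open>a'\<close>.\<close>
      have "rel (graph P X Y g) a' (g \<cdot> a')"
        unfolding rel_graph_iff[OF X Y g a(2) ap[OF g a(2)]] using eq_obj_refl[OF Y ap[OF g a(2)]] .
      then have "rel (snd Y) (f \<cdot> a') (g \<cdot> a')"
        unfolding eq[symmetric] rel_graph_iff[OF X Y f a(2) ap[OF g a(2)]] .
      moreover have "rel (snd Y) (f \<cdot> a) (f \<cdot> a')" using f a unfolding q_reps_iff[OF X Y] by blast
      ultimately show ?thesis
        using eq_obj_trans[OF Y ap[OF f a(1)] ap[OF f a(2)] ap[OF g a(2)]] by blast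
    qed
    with f g show "(f, g) \<in> q_rel P X Y" unfolding q_rel_iff[OF X Y] by blast
  next
    assume fg: "(f, g) \<in> q_rel P X Y"
    have closed: "graph P X Y h \<in> carrier (\<F> (fst X \<otimes> fst Y))" if "h \<in> q_reps P X Y" for h
      using graph_closed[OF X Y] that by (simp add: q_reps_def)
    show "graph P X Y f = graph P X Y g"
    proof (rule eq_rel[OF eq_objD(1)[OF X] eq_objD(1)[OF Y] closed[OF f] closed[OF g]])
      fix Z a b assume a: "a \<in> hom P Z (fst X)" and b: "b \<in> hom P Z (fst Y)"
      have "rel (snd Y) (f \<cdot> a) (g \<cdot> a)"
        using fg a eq_obj_refl[OF X a] unfolding q_rel_iff[OF X Y] by blast
      then show "rel (graph P X Y f) a b \<longleftrightarrow> rel (graph P X Y g) a b"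
        unfolding rel_graph_iff[OF X Y f a b] rel_graph_iff[OF X Y g a b]
        using eq_obj_sym[OF Y ap[OF f a] ap[OF g a]] eq_obj_trans[OF Y ap[OF f a] ap[OF g a] b]
          eq_obj_trans[OF Y ap[OF g a] ap[OF f a] b] by blast
    qed
  }
qed

lemma graph_functional:
  assumes X: "X \<in> eq_obj P" and Y: "Y \<in> eq_obj P" and f: "f \<in> q_reps P X Y"
  shows "is_functional_relation P X Y (graph P X Y f)"
proof -
  have fh: "f \<in> hom P (fst X) (fst Y)" using f by (simp add: q_reps_def)
  have ap: "f \<cdot> a \<in> hom P Z (fst Y)" if "a \<in> hom P Z (fst X)" for a Z
    using that fh comp_hom by blast
  have ext: "rel (snd Y) (f \<cdot> a) (f \<cdot> a')"
    if "a \<in> hom P Z (fst X)" "a' \<in> hom P Z (fst X)" "rel (snd X) a a'" for Z a a'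
    using that f unfolding q_reps_iff[OF X Y] by blast
  show ?thesis
    unfolding functional_relation_iff[OF X Y]
  proof (intro conjI allI ballI impI)
    show "graph P X Y f \<in> carrier (\<F> (fst X \<otimes> fst Y))" by (rule graph_closed[OF X Y fh])
  next
    fix Z a a' b
    assume a: "a \<in> hom P Z (fst X)" "a' \<in> hom P Z (fst X)" and b: "b \<in> hom P Z (fst Y)"
      and r: "rel (snd X) a a' \<and> rel (graph P X Y f) a' b"
    have "rel (snd Y) (f \<cdot> a) (f \<cdot> a')" "rel (snd Y) (f \<cdot> a') b"
      using ext[OF a] r rel_graph_iff[OF X Y f a(2) b] by blast+
    then show "rel (graph P X Y f) a b"
      unfolding rel_graph_iff[OF X Y f a(1) b] by (rule eq_obj_trans[OF Y ap[OF a(1)] ap[OF a(2)] b])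
  next
    fix Z a b b'
    assume a: "a \<in> hom P Z (fst X)" and b: "b \<in> hom P Z (fst Y)" "b' \<in> hom P Z (fst Y)"
      and r: "rel (graph P X Y f) a b \<and> rel (snd Y) b b'"
    then show "rel (graph P X Y f) a b'"
      unfolding rel_graph_iff[OF X Y f a b(1)] rel_graph_iff[OF X Y f a b(2)]
      using eq_obj_trans[OF Y ap[OF a] b] by blast
  next
    fix Z a b b'
    assume a: "a \<in> hom P Z (fst X)" and b: "b \<in> hom P Z (fst Y)" "b' \<in> hom P Z (fst Y)"
      and "rel (graph P X Y f) a b \<and> rel (graph P X Y f) a b'"
    then show "rel (snd Y) b b'"
      unfolding rel_graph_iff[OF X Y f a b(1)] rel_graph_iff[OF X Y f a b(2)]
      using eq_obj_trans[OF Y b(1) ap[OF a] b(2)] eq_obj_sym[OF Y ap[OF a] b(1)] by blast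
  next
    fix Z a assume a: "a \<in> hom P Z (fst X)"
    then show "\<exists>b\<in>hom P Z (fst Y). rel (graph P X Y f) a b"
      using eq_obj_refl[OF Y ap[OF a]] ap[OF a] rel_graph_iff[OF X Y f a] by blast
  qed
qed

text \<open>Totality at the generic element \<open>id\<^sub>A\<close> yields an arrow tracking \<open>\<phi>\<close>.\<close>

lemma functional_relation_is_graph:
  assumes X: "X \<in> eq_obj P" and Y: "Y \<in> eq_obj P" and \<phi>: "is_functional_relation P X Y \<phi>"
  shows "\<exists>f\<in>q_reps P X Y. graph P X Y f = \<phi>"
proof -
  note fr = functional_relationD[OF X Y \<phi>] and obj = eq_objD(1)[OF X] eq_objD(1)[OF Y]
  obtain f where f: "f \<in> hom P (fst X) (fst Y)" "rel \<phi> (Ident P (fst X)) f"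
    using fr(5) ident_hom obj by blast
  have ap: "f \<cdot> a \<in> hom P Z (fst Y)" if "a \<in> hom P Z (fst X)" for a Z
    using that f comp_hom by blast
  have f\<phi>: "rel \<phi> a (f \<cdot> a)" if a: "a \<in> hom P Z (fst X)" for Z a
  proof -
    \<comment> \<open>What holds at the generic element is restricted along
      \<open>a\<close>.\<close>
    have "sat \<phi> (pair P (Ident P (fst X)) f \<cdot> a)"
      using f a fr(1) obj by (intro sat_comp) (auto simp: hom_def)
    then show ?thesis using f a obj by (simp add: hom_def)
  qed
  have reps: "f \<in> q_reps P X Y"
    unfolding q_reps_iff[OF X Y]
  proof (intro conjI allI ballI impI)
    fix Z a a' assume a: "a \<in> hom P Z (fst X)" "a' \<in> hom P Z (fst X)" and "rel (snd X) a a'"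
    \<comment> \<open>Invariance makes \<open>f \<cdot> a'\<close> a second value of \<phi> at
      \<open>a\<close>, besides \<open>f \<cdot> a\<close>; single-valuedness relates them.\<close>
    then have "rel \<phi> a (f \<cdot> a')" using fr(2)[OF a ap[OF a(2)]] f\<phi> by blast
    then show "rel (snd Y) (f \<cdot> a) (f \<cdot> a')"
      using fr(4)[OF a(1) ap[OF a(1)] ap[OF a(2)]] f\<phi>[OF a(1)] by blast
  qed (fact f(1))
  have "graph P X Y f = \<phi>"
  proof (rule eq_rel[OF obj graph_closed[OF X Y f(1)] fr(1)])
    fix Z a b assume a: "a \<in> hom P Z (fst X)" and b: "b \<in> hom P Z (fst Y)"
    \<comment> \<open>As \<open>f \<cdot> a\<close> is a value of \<phi> at \<open>a\<close>, right
      invariance gives one direction and single-valuedness the other.\<close>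
    show "rel (graph P X Y f) a b \<longleftrightarrow> rel \<phi> a b"
      unfolding rel_graph_iff[OF X Y reps a b]
      using fr(3)[OF a ap[OF a] b] fr(4)[OF a ap[OF a] b] f\<phi>[OF a] by blast
  qed
  with reps show ?thesis by blast
qed

lemma graph_ident:
  assumes X: "X \<in> eq_obj P"
  shows "graph P X X (Ident P (fst X)) = snd X"
proof -
  note i = q_reps_ident[OF X]
  show ?thesis
  proof (rule eq_rel[OF eq_objD(1)[OF X] eq_objD(1)[OF X] graph_closed[OF X X] eq_objD(2)[OF X]])
    show "Ident P (fst X) \<in> hom P (fst X) (fst X)" using i by (simp add: q_reps_def)
    fix Z a b assume "a \<in> hom P Z (fst X)" "b \<in> hom P Z (fst X)"
    then show "rel (graph P X X (Ident P (fst X))) a b \<longleftrightarrow> rel (snd X) a b"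
      by (simp add: rel_graph_iff[OF X X i] ident_left)
  qed
qed

text \<open>The intermediate element of the relational composite may be taken to be
  \<open>f \<cdot> a\<close>, because \<open>g\<close> respects the relation of
  \<open>Y\<close>.\<close>

lemma graph_comp:
  assumes X: "X \<in> eq_obj P" and Y: "Y \<in> eq_obj P" and Z: "Z \<in> eq_obj P"
    and f: "f \<in> q_reps P X Y" and g: "g \<in> q_reps P Y Z"
  shows "graph P X Z (g \<cdot> f) = rel_comp P (fst X) (fst Y) (fst Z) (graph P Y Z g) (graph P X Y f)"
proof -
  note obj = eq_objD(1)[OF X] eq_objD(1)[OF Y] eq_objD(1)[OF Z] and gf = q_reps_comp[OF X Y Z f g]
  note closed = functional_relationD(1)[OF X Y graph_functional[OF X Y f]]
    functional_relationD(1)[OF Y Z graph_functional[OF Y Z g]]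
    functional_relationD(1)[OF X Z graph_functional[OF X Z gf]]
  have homs: "f \<in> hom P (fst X) (fst Y)" "g \<in> hom P (fst Y) (fst Z)"
    using f g by (simp_all add: q_reps_def)
  show ?thesis
  proof (rule eq_rel[OF obj(1,3) closed(3) rel_comp_closed[OF obj closed(1,2)]])
    fix W a c assume a: "a \<in> hom P W (fst X)" and c: "c \<in> hom P W (fst Z)"
    have fa: "f \<cdot> a \<in> hom P W (fst Y)" using a homs comp_hom by blast
    have gb: "g \<cdot> b \<in> hom P W (fst Z)" if "b \<in> hom P W (fst Y)" for b using that homs comp_hom by blast
    have "rel (graph P X Z (g \<cdot> f)) a c \<longleftrightarrow> rel (snd Z) (g \<cdot> (f \<cdot> a)) c"
      unfolding rel_graph_iff[OF X Z gf a c] comp_assoc[OF a homs] ..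
    also have "\<dots> \<longleftrightarrow> (\<exists>b\<in>hom P W (fst Y). rel (snd Y) (f \<cdot> a) b \<and> rel (snd Z) (g \<cdot> b) c)"
    proof
      assume "\<exists>b\<in>hom P W (fst Y). rel (snd Y) (f \<cdot> a) b \<and> rel (snd Z) (g \<cdot> b) c"
      then obtain b where b: "b \<in> hom P W (fst Y)" "rel (snd Y) (f \<cdot> a) b" "rel (snd Z) (g \<cdot> b) c"
        by blast
      then have "rel (snd Z) (g \<cdot> (f \<cdot> a)) (g \<cdot> b)"
        using g fa unfolding q_reps_iff[OF Y Z] by blast
      then show "rel (snd Z) (g \<cdot> (f \<cdot> a)) c"
        using eq_obj_trans[OF Z gb[OF fa] gb[OF b(1)] c] b by blast
    qed (use fa eq_obj_refl[OF Y fa] in blast)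
    also have "\<dots> \<longleftrightarrow> rel (rel_comp P (fst X) (fst Y) (fst Z) (graph P Y Z g) (graph P X Y f)) a c"
      unfolding rel_rel_comp_iff[OF obj closed(1,2) a c]
      using rel_graph_iff[OF X Y f a] rel_graph_iff[OF Y Z g _ c] by blast
    finally show "rel (graph P X Z (g \<cdot> f)) a c \<longleftrightarrow>
        rel (rel_comp P (fst X) (fst Y) (fst Z) (graph P Y Z g) (graph P X Y f)) a c" .
  qed
qed

lemma L_obj: "on_obj (L P) X = X"
  by (simp add: L_def)

text \<open>Justifies \<open>the_elem\<close>: the values of \<open>graph\<close> on a class form a
  singleton, as \<open>graph\<close> is constant there and the class is inhabited.\<close>

lemma L_cls:
  assumes X: "X \<in> eq_obj P" and Y: "Y \<in> eq_obj P" and f: "f \<in> q_reps P X Y"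
  shows "on_arr (L P) (cls X Y f) = (X, Y, graph P X Y f)"
proof -
  have "graph P X Y g = graph P X Y f" if g: "(f, g) \<in> q_rel P X Y" for g
  proof -
    have "g \<in> q_reps P X Y" using g by (simp add: q_rel_def)
    then show ?thesis using graph_eq_iff[OF X Y f] g by metis
  qed
  moreover have "(f, f) \<in> q_rel P X Y" using f by (simp add: q_rel_def q_reps_def)
  ultimately have "graph P X Y ` (q_rel P X Y `` {f}) = {graph P X Y f}" by blast
  then show ?thesis by (simp add: L_def)
qed

lemma functor_L: "is_functor (QP P) (EP P) (L P)"
  unfolding is_functor_def
proof (intro conjI ballI)
  show "on_arr (L P) F \<in> hom (EP P) (on_obj (L P) X) (on_obj (L P) Y)" if "F \<in> hom (QP P) X Y" for F X Y
    using that graph_functional[of X Y] by (auto simp: QP_hom_iff EP_hom_iff L_obj L_cls)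
  show "on_arr (L P) (Ident (QP P) X) = Ident (EP P) (on_obj (L P) X)" if "X \<in> Obj (QP P)" for X
    using that q_reps_ident[of X] by (simp add: QP_simps EP_simps L_obj L_cls graph_ident)
  show "on_arr (L P) (G \<cdot>\<^bsub>QP P\<^esub> F) = on_arr (L P) G \<cdot>\<^bsub>EP P\<^esub> on_arr (L P) F"
    if "F \<in> hom (QP P) X Y" "G \<in> hom (QP P) Y Z" for F G X Y Z
    using that q_reps_comp[of X Y Z] by (auto simp: QP_hom_iff QP_comp EP_simps L_cls graph_comp)
qed (simp_all add: category_QP category_EP QP_simps EP_simps L_obj)

section \<open>Bijectivity of \<open>L\<close> and the equivalence\<close>

lemma bij_betw_L_arr: "bij_betw (on_arr (L P)) (Arr (QP P)) (Arr (EP P))"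
proof -
  have QP_arr: "F \<in> Arr (QP P) \<longleftrightarrow> (\<exists>X Y. F \<in> hom (QP P) X Y)" for F
    by (auto simp: hom_def)
  have EP_arr: "F \<in> Arr (EP P) \<longleftrightarrow> (\<exists>X Y. F \<in> hom (EP P) X Y)" for F
    by (auto simp: hom_def)
  show ?thesis
    unfolding bij_betw_def
  proof
    show "inj_on (on_arr (L P)) (Arr (QP P))"
    proof (rule inj_onI)
      fix F G assume F: "F \<in> Arr (QP P)" and G: "G \<in> Arr (QP P)"
        and eq: "on_arr (L P) F = on_arr (L P) G"
      obtain X Y f where f: "X \<in> eq_obj P" "Y \<in> eq_obj P" "f \<in> q_reps P X Y" "F = cls X Y f"
        using F unfolding QP_arr QP_hom_iff by blast
      obtain X' Y' g where g: "X' \<in> eq_obj P" "Y' \<in> eq_obj P" "g \<in> q_reps P X' Y'" "G = cls X' Y' g"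
        using G unfolding QP_arr QP_hom_iff by blast
      \<comment> \<open>The triples record their ends, so equal images come from parallel
        arrows.\<close>
      have "X' = X" "Y' = Y" "graph P X Y f = graph P X Y g" using eq f g by (auto simp: L_cls)
      then have "(f, g) \<in> q_rel P X Y" using graph_eq_iff f g by blast
      from equiv_class_eq[OF equiv_q_rel[OF f(1,2)] this]
      show "F = G" using f g \<open>X' = X\<close> \<open>Y' = Y\<close> by simp
    qed
    show "on_arr (L P) ` Arr (QP P) = Arr (EP P)"
    proof
      show "on_arr (L P) ` Arr (QP P) \<subseteq> Arr (EP P)"
        using graph_functional
        by (force simp: QP_arr EP_arr QP_hom_iff EP_hom_iff L_cls
            simp del: split_paired_All split_paired_Ex)
      show "Arr (EP P) \<subseteq> on_arr (L P) ` Arr (QP P)"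
      proof
        fix \<Phi> assume "\<Phi> \<in> Arr (EP P)"
        then obtain X Y \<phi> where \<phi>: "X \<in> eq_obj P" "Y \<in> eq_obj P" "is_functional_relation P X Y \<phi>"
          "\<Phi> = (X, Y, \<phi>)" unfolding EP_arr EP_hom_iff by blast
        then obtain f where f: "f \<in> q_reps P X Y" "graph P X Y f = \<phi>"
          using functional_relation_is_graph by blast
        then have "cls X Y f \<in> Arr (QP P)" "on_arr (L P) (cls X Y f) = \<Phi>"
          unfolding QP_arr QP_hom_iff using \<phi> by (blast, simp add: L_cls)
        then show "\<Phi> \<in> on_arr (L P) ` Arr (QP P)" by (metis image_eqI)
      qed
    qed
  qed
qed

lemma equivalence_L: "is_equivalence (QP P) (EP P) (L P)"
proof (rule functor_bij_imp_equivalence[OF functor_L _ bij_betw_L_arr])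
  have "on_obj (L P) = id" by (simp add: L_def id_def)
  then show "bij_betw (on_obj (L P)) (Obj (QP P)) (Obj (EP P))" by (simp add: QP_simps EP_simps)
qed

end

theorem theorem4p2:
  fixes P :: "('o, 'a, 'p) doctrine"
  assumes "is_elementary P"
    and "is_existential P"
    and "has_weak_full_comprehensions P"
    and "\<And>A B \<alpha>. \<lbrakk>A \<in> Obj P; B \<in> Obj P; \<alpha> \<in> carrier (fibre P (Prod P A B));
            \<top>\<^bsub>fibre P A\<^esub> \<sqsubseteq>\<^bsub>fibre P A\<^esub> ex P (pr1 P A B) \<alpha>\<rbrakk>
          \<Longrightarrow> \<exists>w\<in>hom P A B. \<top>\<^bsub>fibre P A\<^esub> \<sqsubseteq>\<^bsub>fibre P A\<^esub> reindex P (pair P (Ident P A) w) \<alpha>"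
  shows "is_equivalence (QP P) (EP P) (L P)"
proof -
  interpret choice_doctrine P
    using assms by unfold_locales (auto simp: is_elementary_def)
  show ?thesis by (rule equivalence_L)
qed

end
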